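(* For every $c>0$ and $C\ge 1$ there exists $c^*=c^*(c,C)>0$, independent of $n$, with the following property. Let $n$ be a positive integer and let $\mathcal{H}_1,\mathcal{H}_2,\mathcal{H}_3\subset\mathbb{R}^2$ satisfy $n\le|\mathcal{H}_i|\le Cn$ for $i=1,2,3$. Assume $\mathcal{H}_1$ lies on a straight line $l_1$ and $\mathcal{H}_2$ lies on a straight line $l_2$, with $l_1\ne l_2$, and that $\mathcal{H}_3\cap l_1=\mathcal{H}_3\cap l_2=\emptyset$. Suppose the number of straight lines $l$ for which there exist three distinct points $P_i\in l\cap\mathcal{H}_i$ ($i=1,2,3$) is at least $cn^2$. Then some $c^*n$ points of $\mathcal{H}_3$ are collinear. *)

theory Defs
  imports "HOL-Analysis.Analysis"
begin

definition straight_line :: "(real ^ 2) set \<Rightarrow> bool" where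
  "straight_line l \<longleftrightarrow> affine l \<and> aff_dim l = 1"

text \<open>
  For finite \<open>H1\<close>, \<open>H2\<close>, \<open>H3\<close> the following set is finite, as each of its members is
  determined by two distinct points of \<open>H1 \<union> H2\<close>; hence \<open>card\<close> really counts these lines.
\<close>

definition triple_lines ::
  "(real ^ 2) set \<Rightarrow> (real ^ 2) set \<Rightarrow> (real ^ 2) set \<Rightarrow> (real ^ 2) set set" where
  "triple_lines H1 H2 H3 =
     {l. straight_line l \<and>
         (\<exists>P1 \<in> l \<inter> H1. \<exists>P2 \<in> l \<inter> H2. \<exists>P3 \<in> l \<inter> H3.
            P1 \<noteq> P2 \<and> P1 \<noteq> P3 \<and> P2 \<noteq> P3)}"

end

theory Submission
  imports Defs
begin

text \<open>In suitable coordinates the projection of \<open>l1\<close> to \<open>l2\<close> from a point of \<open>H3\<close> is an affine map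
  \<open>x \<mapsto> a x + b\<close>, and collinear sets of coefficient pairs \<open>(a, b)\<close> come from collinear sets of
  points. So let \<open>L\<close> be a set of at most \<open>N\<close> affine maps which together have \<open>c N\<^sup>2\<close> incidences with an
  \<open>N \<times> N\<close> grid. By Cauchy--Schwarz many quotients \<open>h g\<^sup>-\<^sup>1\<close> with \<open>g, h \<in> L\<close> are rich on a grid; as there are
  only \<open>O(N)\<close> rich lines, \<open>h g\<^sup>-\<^sup>1 = h' g'\<^sup>-\<^sup>1\<close> has at least \<open>e N\<^sup>3\<close> solutions in \<open>L\<close>. Suppose that no line
  contains \<open>\<epsilon> N\<close> points of \<open>L\<close>. After passing to a subset, either all slopes occur boundedly often in
  \<open>L\<close>, and a Kovari--Sos--Turan argument between \<open>L \<times> L\<close> and \<open>L \<times> L\<close> bounds the number of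
  solutions; or all slopes occur often, and an argument in the style of Elekes' sum-product
  theorem applies: each slope \<open>a\<close> relates a set of translations acting on the left to the \<open>a\<close>-dilate of
  one acting on the right, which is possible for boundedly many \<open>a\<close> only.\<close>

text \<open>Every line to be counted meets its grid in a fixed proportion of the side, which is why
  comparing ranks is enough for a linear bound. The obstacle lies in turning energy into lines: with
  \<open>M\<close> about \<open>c' * N\<close>, the double count gives
  \<open>N ^ 5 * (1 + M * P)\<close> for the squared energy, and this contradicts
  \<open>e\<^sup>2 * N ^ 6\<close> only if \<open>P\<close>, the multiplicity of slopes, is bounded
  independently of \<open>c'\<close>. Highly repeated slopes therefore need an argument of their
  own, and the threshold \<open>P\<close> between the two cases has to come from that argument and
  to depend on \<open>e\<close> alone. So the constants are fixed in the order \<open>c\<close>,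
  then \<open>e\<close>, then \<open>P\<close> and \<open>\<epsilon>\<close>, and \<open>c'\<close>
  last. With repeated slopes the poverty of the lines \<open>fst g = a\<close> is what counts: it
  makes exceptional slopes cheap, while a large \<open>P\<close> makes the slopes few. Lines in
  other directions enter in the case of bounded multiplicity.\<close>

section \<open>Double counting, Cauchy--Schwarz and pigeonhole\<close>

lemma card_rel_eq_sum:
  assumes "finite X" "finite Y"
  shows "card {(x, y) \<in> X \<times> Y. R x y} = (\<Sum>x\<in>X. card {y \<in> Y. R x y})"
proof -
  have "{(x, y) \<in> X \<times> Y. R x y} = Sigma X (\<lambda>x. {y \<in> Y. R x y})"
    by auto
  then show ?thesis
    using assms by simp
qed

text \<open>Cauchy--Schwarz for the degrees \<open>card {y \<in> Y. R x y}\<close>; their squares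
  count the pairs of neighbours of \<open>x\<close>.\<close>

lemma card_rel_square_le:
  assumes "finite X" "finite Y"
  shows "(real (card {(x, y) \<in> X \<times> Y. R x y}))\<^sup>2
    \<le> card X * real (card {(x, y, y') \<in> X \<times> Y \<times> Y. R x y \<and> R x y'})"
proof -
  have "{(x, y, y') \<in> X \<times> Y \<times> Y. R x y \<and> R x y'}
      = Sigma X (\<lambda>x. {y \<in> Y. R x y} \<times> {y \<in> Y. R x y})"
    by auto
  then have *: "card {(x, y, y') \<in> X \<times> Y \<times> Y. R x y \<and> R x y'}
      = (\<Sum>x\<in>X. (card {y \<in> Y. R x y})\<^sup>2)"
    using assms by (simp add: card_cartesian_product power2_eq_square)
  show ?thesis
    unfolding * card_rel_eq_sum[OF assms]
    using sum_squared_le_sum_of_squares[of "\<lambda>x. real (card {y \<in> Y. R x y})" X]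
    by (simp add: mult.commute)
qed

lemma card_coincidence_eq_sum:
  assumes "finite X" "finite Y" "finite V" "f ` X \<subseteq> V"
  shows "card {(x, y) \<in> X \<times> Y. f x = g y} = (\<Sum>v\<in>V. card {x \<in> X. f x = v} * card {y \<in> Y. g y = v})"
proof -
  have "{(x, y) \<in> X \<times> Y. f x = g y} = (\<Union>v\<in>V. {x \<in> X. f x = v} \<times> {y \<in> Y. g y = v})"
    using assms(4) by auto
  also have "card \<dots> = (\<Sum>v\<in>V. card ({x \<in> X. f x = v} \<times> {y \<in> Y. g y = v}))"
    using assms by (intro card_UN_disjoint) auto
  finally show ?thesis
    by (simp add: card_cartesian_product)
qed

text \<open>Cauchy--Schwarz for the fibre sizes of \<open>f\<close> and \<open>g\<close> over a
  common value. It separates the two sides, so that each can be bounded by its own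
  collisions.\<close>

lemma card_coincidence_square_le:
  assumes "finite X" "finite Y"
  shows "(real (card {(x, y) \<in> X \<times> Y. f x = g y}))\<^sup>2
    \<le> real (card {(x, x') \<in> X \<times> X. f x = f x'}) * real (card {(y, y') \<in> Y \<times> Y. g y = g y'})"
proof -
  let ?V = "f ` X \<union> g ` Y"
  have fin: "finite ?V" using assms by simp
  have "card {(x, y) \<in> X \<times> Y. f x = g y} = (\<Sum>v\<in>?V. card {x \<in> X. f x = v} * card {y \<in> Y. g y = v})"
    "card {(x, x') \<in> X \<times> X. f x = f x'} = (\<Sum>v\<in>?V. card {x \<in> X. f x = v} * card {x \<in> X. f x = v})"
    "card {(y, y') \<in> Y \<times> Y. g y = g y'} = (\<Sum>v\<in>?V. card {y \<in> Y. g y = v} * card {y \<in> Y. g y = v})"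
    by (rule card_coincidence_eq_sum; use assms fin in auto)+
  then show ?thesis
    using Cauchy_Schwarz_ineq_sum[of "\<lambda>v. real (card {x \<in> X. f x = v})" "\<lambda>v. real (card {y \<in> Y. g y = v})" ?V]
    by (simp only: of_nat_sum of_nat_mult power2_eq_square)
qed

text \<open>Pair each element with the least one of its colour. Only the least elements themselves,
  one per colour and so at most \<open>m\<close>, are left out.\<close>

lemma card_monochromatic_pairs_ge:
  fixes X :: "'a::linorder set" and f :: "'a \<Rightarrow> nat"
  assumes "finite X" "f ` X \<subseteq> {..<m}"
  shows "card X \<le> card {(x, x') \<in> X \<times> X. x < x' \<and> f x = f x'} + m"
proof -
  define lo where "lo x = Min {z \<in> X. f z = f x}" for x
  let ?M = "{x \<in> X. lo x = x}"
  let ?P = "{(x, x') \<in> X \<times> X. x < x' \<and> f x = f x'}"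
  have lo: "lo x \<in> X \<and> f (lo x) = f x \<and> lo x \<le> x" if "x \<in> X" for x
  proof -
    have "finite {z \<in> X. f z = f x}" "{z \<in> X. f z = f x} \<noteq> {}"
      using assms(1) that by auto
    from Min_in[OF this] Min_le[OF this(1), of x] show ?thesis
      using that unfolding lo_def by auto
  qed
  have "inj_on f ?M"
  proof (rule inj_onI)
    fix x y assume "x \<in> ?M" "y \<in> ?M" "f x = f y"
    moreover from this have "lo x = lo y" by (simp add: lo_def)
    ultimately show "x = y" by simp
  qed
  then have "card ?M \<le> card {..<m}"
    using assms by (intro card_inj_on_le[of f]) auto
  moreover have "card (X - ?M) \<le> card ?P"
  proof (rule card_inj_on_le[of "\<lambda>x. (lo x, x)"])
    show "finite ?P"
      by (rule finite_subset[of _ "X \<times> X"]) (use assms in auto)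
    show "(\<lambda>x. (lo x, x)) ` (X - ?M) \<subseteq> ?P"
      using lo by (force simp: less_le)
  qed (auto intro: inj_onI)
  moreover have "card X = card ?M + card (X - ?M)"
    using card_Un_disjoint[of ?M "X - ?M"] assms(1) by (simp add: Un_Diff_cancel Un_absorb1 subset_iff)
  ultimately show ?thesis by simp
qed

section \<open>Rich lines on a grid\<close>

definition rank_in :: "real set \<Rightarrow> real \<Rightarrow> nat" where
  "rank_in A x = card {y \<in> A. y < x}"

lemma rank_in_mono: "finite A \<Longrightarrow> x \<le> y \<Longrightarrow> rank_in A x \<le> rank_in A y"
  unfolding rank_in_def by (intro card_mono) auto

lemma rank_in_strict_mono:
  assumes "finite A" "x \<in> A" "x < y"
  shows "rank_in A x < rank_in A y"
  unfolding rank_in_def using assms by (intro psubset_card_mono) auto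

lemma rank_in_less_card: "finite A \<Longrightarrow> x \<in> A \<Longrightarrow> rank_in A x < card A"
  unfolding rank_in_def by (intro psubset_card_mono) auto

lemma rank_in_eq_iff:
  assumes "finite A" "x \<in> A" "y \<in> A"
  shows "rank_in A x = rank_in A y \<longleftrightarrow> x = y"
  using rank_in_strict_mono[OF assms(1,2), of y] rank_in_strict_mono[OF assms(1,3), of x]
  by (metis less_irrefl linorder_neqE)

abbreviation line_trace :: "real set \<Rightarrow> real set \<Rightarrow> real \<times> real \<Rightarrow> real set" where
  "line_trace A B g \<equiv> {x \<in> A. fst g * x + snd g \<in> B}"

text \<open>Order the points of an increasing line in the grid by the sum of their two ranks. If a line
  has many points, then many pairs of its points are close in both ranks; there are
  only linearly many such pairs per point of the grid, and a pair determines the line.\<close>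

lemma card_rich_lines_le_pos:
  fixes \<Lambda> :: "(real \<times> real) set"
  assumes fin: "finite A" "finite B" "finite \<Lambda>" and s: "s > 0"
    and pos: "\<And>g. g \<in> \<Lambda> \<Longrightarrow> fst g > 0"
    and rich: "\<And>g. g \<in> \<Lambda> \<Longrightarrow> (card A + card B) div s + 1 + k \<le> card (line_trace A B g)"
  shows "card \<Lambda> * k \<le> card A * card B * s\<^sup>2"
proof -
  \<comment> \<open>The blocks of \<open>s\<close> consecutive values of \<open>f g\<close> serve as
    colours; there are at most \<open>(card A + card B) div s + 1\<close> of them.\<close>
  define f where "f g x = rank_in A x + rank_in B (fst g * x + snd g)" for g x
  define P where "P g = {(x, x') \<in> line_trace A B g \<times> line_trace A B g. x < x' \<and> f g x div s = f g x' div s}" for g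
  have finP: "finite (P g)" for g
    unfolding P_def by (rule finite_subset[of _ "A \<times> A"]) (use fin in auto)
  have kP: "k \<le> card (P g)" if "g \<in> \<Lambda>" for g
  proof -
    have "(\<lambda>x. f g x div s) ` line_trace A B g \<subseteq> {..<(card A + card B) div s + 1}"
    proof clarsimp
      fix x assume "x \<in> A" "fst g * x + snd g \<in> B"
      then have "f g x \<le> card A + card B"
        unfolding f_def using rank_in_less_card[OF fin(1)] rank_in_less_card[OF fin(2)]
        by (meson add_mono less_imp_le)
      then show "f g x div s < Suc ((card A + card B) div s)"
        by (simp add: div_le_mono less_Suc_eq_le)
    qed
    from card_monochromatic_pairs_ge[OF _ this] fin rich[OF that] show ?thesis
      unfolding P_def by simp
  qed
  \<comment> \<open>A pair is encoded by its left point and two rank differences, both below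
    \<open>s\<close>. The ranks recover the right point, and two points with distinct abscissae
    determine the line.\<close>
  define \<phi> where "\<phi> = (\<lambda>(g::real \<times> real, x::real, x'::real). ((x, fst g * x + snd g),
      (rank_in A x' - rank_in A x, rank_in B (fst g * x' + snd g) - rank_in B (fst g * x + snd g))))"
  have close: "rank_in A x \<le> rank_in A x' \<and> rank_in A x' < rank_in A x + s \<and>
      rank_in B (fst g * x + snd g) \<le> rank_in B (fst g * x' + snd g) \<and>
      rank_in B (fst g * x' + snd g) < rank_in B (fst g * x + snd g) + s \<and>
      x \<in> A \<and> x' \<in> A \<and> fst g * x + snd g \<in> B \<and> fst g * x' + snd g \<in> B \<and> x < x'"
    if "g \<in> \<Lambda>" "(x, x') \<in> P g" for g x x'
  proof -
    have x: "x \<in> A" "x' \<in> A" "fst g * x + snd g \<in> B" "fst g * x' + snd g \<in> B" "x < x'"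
      and same: "f g x div s = f g x' div s"
      using that(2) unfolding P_def by auto
    \<comment> \<open>Positive slope makes both ranks grow, so an increase of their sum by less than
      \<open>s\<close> bounds each increase separately; with negative slope they could
      cancel.\<close>
    have "fst g * x + snd g \<le> fst g * x' + snd g"
      using pos[OF that(1)] x(5) by simp
    then have "rank_in B (fst g * x + snd g) \<le> rank_in B (fst g * x' + snd g)"
      by (rule rank_in_mono[OF fin(2)])
    moreover have "rank_in A x \<le> rank_in A x'"
      by (rule rank_in_mono[OF fin(1)]) (use x in simp)
    moreover have "f g x' < f g x + s"
    proof -
      have "f g x' = f g x div s * s + f g x' mod s"
        using same by (metis div_mult_mod_eq)
      moreover have "f g x div s * s \<le> f g x" by simp
      moreover have "f g x' mod s < s" using s by simp
      ultimately show ?thesis by linarith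
    qed
    ultimately show ?thesis
      using x unfolding f_def by linarith
  qed
  have "card \<Lambda> * k \<le> (\<Sum>g\<in>\<Lambda>. card (P g))"
    using sum_bounded_below[of \<Lambda> k "\<lambda>g. card (P g)"] kP by simp
  also have "\<dots> = card (Sigma \<Lambda> P)"
    using fin finP by simp
  also have "\<dots> \<le> card ((A \<times> B) \<times> ({..<s} \<times> {..<s}))"
  proof (rule card_inj_on_le[of \<phi>])
    show "\<phi> ` Sigma \<Lambda> P \<subseteq> (A \<times> B) \<times> ({..<s} \<times> {..<s})"
      unfolding \<phi>_def using close by fastforce
    show "inj_on \<phi> (Sigma \<Lambda> P)"
    proof (rule inj_onI)
      fix u v
      assume "u \<in> Sigma \<Lambda> P" "v \<in> Sigma \<Lambda> P" "\<phi> u = \<phi> v"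
      moreover obtain a b x x' where u: "u = ((a, b), x, x')"
        by (metis surj_pair)
      moreover obtain c d z z' where v: "v = ((c, d), z, z')"
        by (metis surj_pair)
      ultimately have g: "(a, b) \<in> \<Lambda>" "(x, x') \<in> P (a, b)"
        and h: "(c, d) \<in> \<Lambda>" "(z, z') \<in> P (c, d)"
        and eq: "\<phi> ((a, b), x, x') = \<phi> ((c, d), z, z')"
        by auto
      note cg = close[OF g] and ch = close[OF h]
      have [simp]: "z = x" and y: "a * x + b = c * x + d"
        using eq unfolding \<phi>_def by auto
      have "rank_in A x' = rank_in A z'"
        "rank_in B (a * x' + b) = rank_in B (c * z' + d)"
        using eq cg ch y unfolding \<phi>_def by auto
      then have [simp]: "z' = x'" and y': "a * x' + b = c * x' + d"
        using cg ch fin by (auto simp: rank_in_eq_iff)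
      have "(a - c) * (x' - x) = 0"
        using y y' by (simp add: algebra_simps)
      then have "a = c" using cg by simp
      then show "u = v"
        using y u v by simp
    qed
    show "finite ((A \<times> B) \<times> ({..<s} \<times> {..<s}))" using fin by simp
  qed
  finally show ?thesis
    by (simp add: card_cartesian_product power2_eq_square)
qed

text \<open>Reflecting \<open>A\<close> at the origin makes the slopes positive.\<close>

lemma card_rich_lines_le_neg:
  fixes \<Lambda> :: "(real \<times> real) set"
  assumes fin: "finite A" "finite B" "finite \<Lambda>" and s: "s > 0"
    and neg: "\<And>g. g \<in> \<Lambda> \<Longrightarrow> fst g < 0"
    and rich: "\<And>g. g \<in> \<Lambda> \<Longrightarrow> (card A + card B) div s + 1 + k \<le> card (line_trace A B g)"
  shows "card \<Lambda> * k \<le> card A * card B * s\<^sup>2"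
proof -
  let ?r = "\<lambda>g::real \<times> real. (- fst g, snd g)"
  have tr: "line_trace (uminus ` A) B (?r g) = uminus ` line_trace A B g" for g
    by (auto simp: image_iff add.commute)
  have cA: "card (uminus ` A) = card A"
    by (simp add: card_image)
  have "inj_on ?r \<Lambda>"
    by (auto intro!: inj_onI simp: prod_eq_iff)
  then have c: "card (?r ` \<Lambda>) = card \<Lambda>"
    by (rule card_image)
  have "card (?r ` \<Lambda>) * k \<le> card (uminus ` A) * card B * s\<^sup>2"
  proof (rule card_rich_lines_le_pos)
    fix h assume "h \<in> ?r ` \<Lambda>"
    then obtain g where g: "g \<in> \<Lambda>" "h = ?r g" by blast
    show "fst h > 0" using neg g by simp
    show "(card (uminus ` A) + card B) div s + 1 + k \<le> card (line_trace (uminus ` A) B h)"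
      unfolding g(2) tr cA using rich[OF g(1)] by (simp add: card_image)
  qed (use fin s in auto)
  then show ?thesis unfolding c cA .
qed

lemma card_rich_lines_le:
  fixes \<theta> :: real
  assumes "\<theta> > 0"
  obtains K :: real where "K > 0"
    and "\<And>A B \<Lambda> (n::nat). \<lbrakk>finite A; finite B; finite \<Lambda>; card A + card B \<le> n; \<theta> * n \<ge> 4;
        \<And>g. g \<in> \<Lambda> \<Longrightarrow> fst g \<noteq> 0 \<and> \<theta> * n \<le> card (line_trace A B g)\<rbrakk>
      \<Longrightarrow> card \<Lambda> \<le> K * n"
proof
  \<comment> \<open>At \<open>4 / \<theta>\<close> the quotient
    \<open>(card A + card B) div s\<close> is at most \<open>\<theta> * n / 4\<close>. With
    \<open>k\<close> about \<open>\<theta> * n / 4\<close> as well, the required richness stays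
    within \<open>\<theta> * n\<close>; the rounding is covered by
    \<open>\<theta> * n \<ge> 4\<close>.\<close>
  define s where "s = nat \<lceil>4 / \<theta>\<rceil>"
  define K where "K = 8 * (real s)\<^sup>2 / \<theta>"
  have s: "real s \<ge> 4 / \<theta>" "s > 0"
    unfolding s_def using assms by (auto simp: of_nat_ceiling)
  show "K > 0" unfolding K_def using s assms by simp
  fix A B :: "real set" and \<Lambda> and n :: nat
  assume fin: "finite A" "finite B" "finite \<Lambda>" and n: "card A + card B \<le> n" "\<theta> * n \<ge> 4"
    and rich: "\<And>g. g \<in> \<Lambda> \<Longrightarrow> fst g \<noteq> 0 \<and> \<theta> * n \<le> card (line_trace A B g)"
  define k where "k = nat \<lceil>\<theta> * n / 4\<rceil>"
  have k: "real k \<ge> \<theta> * n / 4" "real k \<le> \<theta> * n / 4 + 1"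
    unfolding k_def using n(2) by (linarith+)
  have "real ((card A + card B) div s) \<le> real n / s"
    using of_nat_div_le_of_nat[of "card A + card B" s, where 'a = real] n(1)
    by (smt (verit) divide_right_mono of_nat_0_le_iff of_nat_mono)
  also have "\<dots> \<le> n * (\<theta> / 4)"
  proof -
    have "1 / real s \<le> \<theta> / 4"
      using s assms by (simp add: field_simps)
    then show ?thesis using mult_left_mono[of "1 / real s" "\<theta> / 4" "real n"] by simp
  qed
  finally have d: "real ((card A + card B) div s) \<le> \<theta> * n / 4" by (simp add: mult.commute)
  have rich': "(card A + card B) div s + 1 + k \<le> card (line_trace A B g)" if "g \<in> \<Lambda>" for g
  proof -
    have "real ((card A + card B) div s + 1 + k) \<le> \<theta> * n"
      using d k n(2) by simp
    then show ?thesis using rich[OF that] by linarith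
  qed
  let ?p = "{g \<in> \<Lambda>. fst g > 0}" and ?m = "{g \<in> \<Lambda>. fst g < 0}"
  have "card ?p * k \<le> card A * card B * s\<^sup>2" "card ?m * k \<le> card A * card B * s\<^sup>2"
    by (rule card_rich_lines_le_pos card_rich_lines_le_neg; use fin s rich' in simp)+
  moreover have "card \<Lambda> \<le> card ?p + card ?m"
  proof -
    have "\<Lambda> = ?p \<union> ?m" using rich by force
    then show ?thesis by (metis card_Un_le)
  qed
  ultimately have "card \<Lambda> * k \<le> 2 * (card A * card B * s\<^sup>2)"
    using mult_le_mono1[of "card \<Lambda>" "card ?p + card ?m" k] by (simp add: distrib_right)
  also have "\<dots> \<le> 2 * (n * n * s\<^sup>2)"
    using n(1) by (intro mult_le_mono) auto
  finally have "real (card \<Lambda>) * k \<le> 2 * (real n * n * (real s)\<^sup>2)"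
    using of_nat_mono[of "card \<Lambda> * k" "2 * (n * n * s\<^sup>2)", where 'a = real] by simp
  moreover have "real (card \<Lambda>) * (\<theta> * n / 4) \<le> real (card \<Lambda>) * k"
    using k by (intro mult_left_mono) auto
  ultimately have "real (card \<Lambda>) * (\<theta> * n / 4) \<le> 2 * (real n * n * (real s)\<^sup>2)" by linarith
  moreover have "n > 0" using n(2) by (cases n) auto
  ultimately show "card \<Lambda> \<le> K * n"
    unfolding K_def using assms by (simp add: field_simps power2_eq_square)
qed

section \<open>The affine group and the lower bound for the energy\<close>

text \<open>The pair \<open>(a, b)\<close> stands for the map \<open>x \<mapsto> a * x + b\<close>;
  the product is composition, the right factor being applied first.\<close>

definition aff_mult :: "real \<times> real \<Rightarrow> real \<times> real \<Rightarrow> real \<times> real"  (infixl "\<odot>" 70) where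
  "g \<odot> h = (fst g * fst h, fst g * snd h + snd g)"

definition aff_inv :: "real \<times> real \<Rightarrow> real \<times> real" where
  "aff_inv g = (1 / fst g, - snd g / fst g)"

lemma fst_aff_mult [simp]: "fst (g \<odot> h) = fst g * fst h"
  by (simp add: aff_mult_def)

lemma fst_aff_inv [simp]: "fst (aff_inv g) = 1 / fst g"
  by (simp add: aff_inv_def)

lemma aff_mult_assoc: "g \<odot> h \<odot> k = g \<odot> (h \<odot> k)"
  by (simp add: aff_mult_def algebra_simps)

lemma aff_mult_inv_cancel [simp]:
  assumes "fst g \<noteq> 0"
  shows "h \<odot> aff_inv g \<odot> g = h" "h \<odot> g \<odot> aff_inv g = h" "g \<odot> (aff_inv g \<odot> h) = h" "aff_inv g \<odot> (g \<odot> h) = h"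
  using assms by (auto simp: aff_mult_def aff_inv_def prod_eq_iff field_simps)

text \<open>Its cardinality is the multiplicative energy of \<open>L\<close> in the affine
  group.\<close>

definition energy_set :: "(real \<times> real) set \<Rightarrow> (((real \<times> real) \<times> real \<times> real) \<times> (real \<times> real) \<times> real \<times> real) set" where
  "energy_set L = {((g, h), (g', h')) \<in> (L \<times> L) \<times> (L \<times> L). h \<odot> aff_inv g = h' \<odot> aff_inv g'}"

lemma finite_energy_set: "finite L \<Longrightarrow> finite (energy_set L)"
  unfolding energy_set_def by (rule finite_subset[of _ "(L \<times> L) \<times> (L \<times> L)"]) auto

text \<open>Cauchy--Schwarz for the fibres of \<open>f\<close>: a map with few values has many
  collisions.\<close>

lemma card_square_le_card_image:
  assumes "finite X"
  shows "(real (card X))\<^sup>2 \<le> real (card (f ` X)) * real (card {(x, x') \<in> X \<times> X. f x = f x'})"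
proof -
  let ?V = "f ` X"
  have *: "card {(v, x) \<in> ?V \<times> X. f x = v} = card X"
    by (rule bij_betw_same_card[of snd]) (auto simp: bij_betw_def inj_on_def image_iff)
  have "{(v, x, x') \<in> ?V \<times> X \<times> X. f x = v \<and> f x' = v} = (\<lambda>(x, x'). (f x, x, x')) ` {(x, x') \<in> X \<times> X. f x = f x'}"
    by (auto simp: image_iff)
  moreover have "inj_on (\<lambda>(x, x'). (f x, x, x')) {(x, x') \<in> X \<times> X. f x = f x'}"
    by (auto intro: inj_onI)
  ultimately have "card {(v, x, x') \<in> ?V \<times> X \<times> X. f x = v \<and> f x' = v} = card {(x, x') \<in> X \<times> X. f x = f x'}"
    by (simp add: card_image)
  then show ?thesis
    using card_rel_square_le[of ?V X "\<lambda>v x. f x = v"] assms unfolding * by simp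
qed

text \<open>The quotient \<open>h \<odot> aff_inv g\<close> sends the image of \<open>x\<close>
  under \<open>g\<close> to its image under \<open>h\<close>. Hence the points of \<open>A\<close>
  that both maps send into \<open>B\<close> make the quotient rich on
  \<open>B \<times> B\<close>.\<close>

lemma energy_ge:
  fixes c :: real
  assumes "c > 0"
  obtains e :: real where "e > 0"
    and "\<And>A B L N. \<lbrakk>finite A; finite B; finite L; card A \<le> N; card B \<le> N; card L \<le> N;
        \<And>g. g \<in> L \<Longrightarrow> fst g \<noteq> 0;
        c * (real N)\<^sup>2 \<le> card {(x, g) \<in> A \<times> L. fst g * x + snd g \<in> B}\<rbrakk>
      \<Longrightarrow> e * real N ^ 3 \<le> card (energy_set L)"
proof -
  \<comment> \<open>Pairs with fewer than \<open>\<theta> * (2 * N)\<close> common points contribute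
    at most \<open>c\<^sup>2 / 2 * N ^ 3\<close>, half of the total that Cauchy--Schwarz
    provides.\<close>
  define \<theta> where "\<theta> = c\<^sup>2 / 4"
  have \<theta>: "\<theta> > 0" using assms by (simp add: \<theta>_def)
  from card_rich_lines_le[OF this] obtain K :: real where K: "K > 0"
    and rich_le: "\<And>A B \<Lambda> (n::nat). \<lbrakk>finite A; finite B; finite \<Lambda>; card A + card B \<le> n; \<theta> * n \<ge> 4;
        \<And>g. g \<in> \<Lambda> \<Longrightarrow> fst g \<noteq> 0 \<and> \<theta> * n \<le> card (line_trace A B g)\<rbrakk>
      \<Longrightarrow> card \<Lambda> \<le> K * n"
    by blast
  define e where "e = min (c ^ 4 / (8 * K)) ((\<theta> / 2) ^ 3)"
  have "e > 0" using assms K \<theta> by (simp add: e_def)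
  moreover have "e * real N ^ 3 \<le> card (energy_set L)"
    if fin: "finite A" "finite B" "finite L" and N: "card A \<le> N" "card B \<le> N" "card L \<le> N"
      and nz: "\<And>g. g \<in> L \<Longrightarrow> fst g \<noteq> 0"
      and inc: "c * (real N)\<^sup>2 \<le> card {(x, g) \<in> A \<times> L. fst g * x + snd g \<in> B}"
    for A B L N
  proof (cases "N = 0")
    case True
    then show ?thesis by simp
  next
    case N0: False
    show ?thesis
    proof (cases "\<theta> * (2 * N) \<ge> 4")
      case False
      then have "\<theta> / 2 * N \<le> 1" by simp
      then have "(\<theta> / 2 * N) ^ 3 \<le> 1"
        using \<theta> by (intro power_le_one) auto
      then have "e * real N ^ 3 \<le> 1"
        using mult_right_mono[of e "(\<theta> / 2) ^ 3" "real N ^ 3"]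
        by (simp only: e_def power_mult_distrib) simp
      moreover have "energy_set L \<noteq> {}"
      proof -
        have "0 < c * (real N)\<^sup>2" using assms N0 by simp
        then have "{(x, g) \<in> A \<times> L. fst g * x + snd g \<in> B} \<noteq> {}"
          using inc by (metis card.empty not_le of_nat_0)
        then obtain g where "g \<in> L" by auto
        then have "((g, g), (g, g)) \<in> energy_set L" by (simp add: energy_set_def)
        then show ?thesis by auto
      qed
      then have "card (energy_set L) \<ge> 1"
        using finite_energy_set[OF fin(3)] by (simp add: Suc_leI card_gt_0_iff)
      ultimately show ?thesis by linarith
    next
      case True
      let ?R = "\<lambda>x g. fst g * x + snd g \<in> B"
      define w where "w p = card {x \<in> A. ?R x (fst p) \<and> ?R x (snd p)}" for p
      have w_le: "w p \<le> N" for p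
        unfolding w_def using N(1) card_mono[OF fin(1), of "{x \<in> A. ?R x (fst p) \<and> ?R x (snd p)}"] by auto
      define \<rho> where "\<rho> = {p \<in> L \<times> L. \<theta> * (2 * N) \<le> w p}"
      have fin\<rho>: "finite \<rho>" unfolding \<rho>_def using fin by simp
      have J: "card {(x, g, h) \<in> A \<times> L \<times> L. ?R x g \<and> ?R x h} = (\<Sum>p\<in>L \<times> L. w p)"
      proof -
        have "card {(x, g, h) \<in> A \<times> L \<times> L. ?R x g \<and> ?R x h}
            = card {(p, x) \<in> (L \<times> L) \<times> A. ?R x (fst p) \<and> ?R x (snd p)}"
          by (rule bij_betw_same_card[of "\<lambda>(x, p). (p, x)"]) (auto simp: bij_betw_def inj_on_def image_iff)
        then show ?thesis
          unfolding w_def using fin by (subst (asm) card_rel_eq_sum) auto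
      qed
      have "(c * (real N)\<^sup>2)\<^sup>2 \<le> (real (card {(x, g) \<in> A \<times> L. ?R x g}))\<^sup>2"
        using inc assms by (intro power_mono) auto
      also have "\<dots> \<le> card A * real (card {(x, g, h) \<in> A \<times> L \<times> L. ?R x g \<and> ?R x h})"
        using card_rel_square_le[of A L ?R] fin by blast
      also have "\<dots> \<le> N * real (\<Sum>p\<in>L \<times> L. w p)"
        unfolding J using N by (intro mult_right_mono) (auto intro: sum_nonneg)
      finally have "N * (c\<^sup>2 * real N ^ 3) \<le> N * real (\<Sum>p\<in>L \<times> L. w p)"
        by (simp add: power_mult_distrib power2_eq_square power3_eq_cube mult_ac)
      then have low: "c\<^sup>2 * real N ^ 3 \<le> real (\<Sum>p\<in>L \<times> L. w p)"
        using N0 by simp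
      have "real (\<Sum>p\<in>L \<times> L. w p) \<le> (\<Sum>p\<in>L \<times> L. (if p \<in> \<rho> then real N else 0) + \<theta> * (2 * N))"
        unfolding of_nat_sum using w_le \<theta> by (intro sum_mono) (auto simp: \<rho>_def add_increasing2)
      also have "\<dots> = (\<Sum>p\<in>L \<times> L. if p \<in> \<rho> then real N else 0) + (card L)\<^sup>2 * (\<theta> * (2 * N))"
        by (simp add: sum.distrib card_cartesian_product power2_eq_square)
      also have "(\<Sum>p\<in>L \<times> L. if p \<in> \<rho> then real N else 0) = card \<rho> * real N"
        using fin by (simp add: sum.If_cases \<rho>_def Int_def conj_ac)
      also have "(card L)\<^sup>2 * (\<theta> * (2 * N)) \<le> (real N)\<^sup>2 * (\<theta> * (2 * N))"
        using N \<theta> by (intro mult_right_mono) auto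
      finally have "c\<^sup>2 * real N ^ 3 \<le> card \<rho> * real N + c\<^sup>2 / 2 * real N ^ 3"
        using low by (simp add: \<theta>_def power2_eq_square power3_eq_cube mult_ac)
      then have "(c\<^sup>2 / 2 * (real N)\<^sup>2) * real N \<le> card \<rho> * real N"
        by (simp add: power2_eq_square power3_eq_cube field_simps)
      then have \<rho>: "c\<^sup>2 / 2 * (real N)\<^sup>2 \<le> card \<rho>"
        using N0 by simp
      define \<tau> where "\<tau> p = snd p \<odot> aff_inv (fst p)" for p
      have "card (\<tau> ` \<rho>) \<le> K * real (2 * N)"
      proof (rule rich_le)
        fix T assume "T \<in> \<tau> ` \<rho>"
        then obtain g h where gh: "g \<in> L" "h \<in> L" "\<theta> * (2 * N) \<le> w (g, h)" "T = \<tau> (g, h)"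
          unfolding \<rho>_def by auto
        have "w (g, h) \<le> card (line_trace B B T)"
          unfolding w_def
        proof (rule card_inj_on_le[of "\<lambda>x. fst g * x + snd g"])
          show "inj_on (\<lambda>x. fst g * x + snd g) {x \<in> A. ?R x (fst (g, h)) \<and> ?R x (snd (g, h))}"
            using nz[OF gh(1)] by (auto intro: inj_onI)
          have "fst T * (fst g * x + snd g) + snd T = fst h * x + snd h" for x
            using nz[OF gh(1)] unfolding gh(4) \<tau>_def aff_mult_def aff_inv_def by (simp add: field_simps)
          then show "(\<lambda>x. fst g * x + snd g) ` {x \<in> A. ?R x (fst (g, h)) \<and> ?R x (snd (g, h))} \<subseteq> line_trace B B T"
            by auto
        qed (use fin in auto)
        then show "fst T \<noteq> 0 \<and> \<theta> * real (2 * N) \<le> card (line_trace B B T)"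
          using gh nz unfolding \<tau>_def by auto
      qed (use fin fin\<rho> N True in auto)
      have "(c\<^sup>2 / 2 * (real N)\<^sup>2)\<^sup>2 \<le> (real (card \<rho>))\<^sup>2"
        using \<rho> by (intro power_mono) auto
      also have "\<dots> \<le> real (card (\<tau> ` \<rho>)) * real (card {(p, q) \<in> \<rho> \<times> \<rho>. \<tau> p = \<tau> q})"
        by (rule card_square_le_card_image[OF fin\<rho>])
      also have "\<dots> \<le> (K * real (2 * N)) * real (card (energy_set L))"
      proof (rule mult_mono)
        have "card {(p, q) \<in> \<rho> \<times> \<rho>. \<tau> p = \<tau> q} \<le> card (energy_set L)"
          by (rule card_mono[OF finite_energy_set[OF fin(3)]]) (auto simp: energy_set_def \<rho>_def \<tau>_def)
        then show "real (card {(p, q) \<in> \<rho> \<times> \<rho>. \<tau> p = \<tau> q}) \<le> real (card (energy_set L))" by simp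
      qed (use \<open>card (\<tau> ` \<rho>) \<le> K * real (2 * N)\<close> K in auto)
      finally have "N * (c ^ 4 * real N ^ 3) \<le> N * (8 * K * real (card (energy_set L)))"
        by (simp add: power_mult_distrib power_divide power2_eq_square power3_eq_cube power4_eq_xxxx mult_ac)
      then have "c ^ 4 * real N ^ 3 \<le> 8 * K * real (card (energy_set L))"
        using N0 by simp
      then have "c ^ 4 / (8 * K) * real N ^ 3 \<le> card (energy_set L)"
        using K by (simp add: field_simps)
      moreover have "e * real N ^ 3 \<le> c ^ 4 / (8 * K) * real N ^ 3"
        by (intro mult_right_mono) (auto simp: e_def)
      ultimately show ?thesis by linarith
    qed
  qed
  ultimately show thesis by (rule that)
qed

section \<open>Energy when every slope occurs boundedly often\<close>

text \<open>For fixed \<open>g'\<close> and \<open>h\<close> the equation \<open>h g\<^sup>-\<^sup>1 = h' g'\<^sup>-\<^sup>1\<close> is linear in the projective coordinates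
  \<open>(1/a, b/a, snd h')\<close> of the pair \<open>(g, h')\<close>, where \<open>g = (a, b)\<close>. Two such conditions force \<open>g\<close> onto a line,
  and \<open>g\<close> determines \<open>h'\<close>; so two distinct pairs \<open>(g', h)\<close> have at most \<open>M\<close> common solutions.\<close>

lemma energy_small_fibres:
  fixes L :: "(real \<times> real) set"
  assumes fin: "finite L" and N: "card L \<le> N"
    and nz: "\<And>g. g \<in> L \<Longrightarrow> fst g \<noteq> 0"
    and P: "\<And>a. card {g \<in> L. fst g = a} \<le> P"
    and M: "\<And>u v w. (u, v) \<noteq> (0, 0) \<Longrightarrow> card {g \<in> L. u * fst g + v * snd g = w} \<le> M"
  shows "(real (card (energy_set L)))\<^sup>2 \<le> real N ^ 5 * (1 + real M * real P)"
proof -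
  \<comment> \<open>The four maps are regrouped as \<open>x = (g, h')\<close> and
    \<open>y = (g', h)\<close>, so that a solution is an edge of a bipartite graph, to which the
    Kovari--Sos--Turan count applies.\<close>
  define rel where "rel x y \<longleftrightarrow> snd y \<odot> aff_inv (fst x) = snd x \<odot> aff_inv (fst y)"
    for x y :: "(real \<times> real) \<times> (real \<times> real)"
  let ?X = "L \<times> L"
  let ?E = "{(x, y) \<in> ?X \<times> ?X. rel x y}"
  let ?F = "{(x, y, y') \<in> ?X \<times> ?X \<times> ?X. rel x y \<and> rel x y'}"
  have E: "card (energy_set L) = card ?E"
    by (rule bij_betw_same_card[of "\<lambda>((g, h), (g', h')). ((g, h'), (g', h))"])
      (auto simp: bij_betw_def inj_on_def image_iff energy_set_def rel_def)
  have det: "h' = h \<odot> aff_inv g \<odot> g'" if "rel (g, h') (g', h)" "g' \<in> L" for g h g' h'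
    using that nz by (simp add: rel_def)
  \<comment> \<open>Only pairs \<open>y\<close>, \<open>y'\<close> with equal products of slopes can
    share a neighbour. There are at most \<open>N ^ 3 * P\<close> of them instead of
    \<open>N ^ 4\<close>, which is where \<open>P\<close> enters.\<close>
  have slope: "fst (fst y) * fst (snd y) = fst (fst x) * fst (snd x)"
    if "x \<in> ?X" "y \<in> ?X" "rel x y" for x y
  proof -
    have "fst (fst x) \<noteq> 0" "fst (fst y) \<noteq> 0" using that nz by (auto simp: mem_Times_iff)
    moreover have "fst (snd y \<odot> aff_inv (fst x)) = fst (snd x \<odot> aff_inv (fst y))"
      using that(3) by (simp add: rel_def)
    ultimately show ?thesis by (simp add: field_simps)
  qed
  have share: "card {x \<in> ?X. rel x y \<and> rel x y'} \<le> M"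
    if y: "y \<in> ?X" "y' \<in> ?X" "y \<noteq> y'" "fst (fst y) * fst (snd y) = fst (fst y') * fst (snd y')" for y y'
  proof -
    obtain a b c d where y_eq: "y = ((a, b), (c, d))" by (metis surj_pair)
    obtain a' b' c' d' where y'_eq: "y' = ((a', b'), (c', d'))" by (metis surj_pair)
    have nz': "a \<noteq> 0" "c \<noteq> 0" "a' \<noteq> 0" "c' \<noteq> 0"
      using y(1,2) nz unfolding y_eq y'_eq by fastforce+
    let ?G = "{g \<in> L. (d - d') * fst g + (c' - c) * snd g = c' * b' - c * b}"
    have on_line: "fst x \<in> ?G" if x: "x \<in> ?X" "rel x y" "rel x y'" for x
    proof -
      obtain g h where x_eq: "x = (g, h)" by (metis surj_pair)
      have g: "g \<in> L" "fst g \<noteq> 0" using x(1) nz unfolding x_eq by auto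
      have "(c, d) \<odot> aff_inv g \<odot> (a, b) = (c', d') \<odot> aff_inv g \<odot> (a', b')"
        using det[of g h "(a, b)" "(c, d)"] det[of g h "(a', b')" "(c', d')"] x(2,3) y(1,2)
        unfolding x_eq y_eq y'_eq by auto
      then have "c / fst g * b - c * snd g / fst g + d = c' / fst g * b' - c' * snd g / fst g + d'"
        by (simp add: aff_mult_def aff_inv_def)
      then have "(d - d') * fst g + (c' - c) * snd g = c' * b' - c * b"
        using g(2) by (simp add: field_simps)
      then show ?thesis using g unfolding x_eq by simp
    qed
    have "card {x \<in> ?X. rel x y \<and> rel x y'} \<le> card ?G"
    proof (rule card_inj_on_le[of fst])
      show "inj_on fst {x \<in> ?X. rel x y \<and> rel x y'}"
      proof (rule inj_onI)
        fix x x' assume x: "x \<in> {x \<in> ?X. rel x y \<and> rel x y'}" "x' \<in> {x \<in> ?X. rel x y \<and> rel x y'}"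
          and eq: "fst x = fst x'"
        then have "rel (fst x, snd x) ((a, b), (c, d))" "rel (fst x, snd x') ((a, b), (c, d))"
          unfolding y_eq by auto
        then have "snd x = snd x'"
          using det[of "fst x" "snd x" "(a, b)" "(c, d)"] det[of "fst x" "snd x'" "(a, b)" "(c, d)"] y(1)
          unfolding y_eq by auto
        then show "x = x'" using eq by (simp add: prod_eq_iff)
      qed
    qed (use on_line fin in auto)
    also have "\<dots> \<le> M"
    \<comment> \<open>The linear condition on \<open>g\<close> degenerates only for
      \<open>c = c'\<close> and \<open>d = d'\<close>. Equal slope products then give
      \<open>a = a'\<close>, so \<open>b \<noteq> b'\<close> and the condition has no
      solution.\<close>
    proof (cases "d = d' \<and> c = c'")
      case False
      then show ?thesis by (intro M) auto
    next
      case True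
      then have "a = a'" using y(4) nz' unfolding y_eq y'_eq by simp
      then have "b \<noteq> b'" using y(3) True unfolding y_eq y'_eq by simp
      then have "?G = {}" using True nz' by auto
      then show ?thesis by (metis card.empty le0)
    qed
    finally show ?thesis .
  qed
  let ?D = "{(y, y') \<in> ?X \<times> ?X. y \<noteq> y' \<and> fst (fst y) * fst (snd y) = fst (fst y') * fst (snd y')}"
  have finD: "finite ?D"
    by (rule finite_subset[of _ "?X \<times> ?X"]) (use fin in auto)
  have D: "card ?D \<le> N ^ 3 * P"
  proof -
    let ?S = "Sigma ((L \<times> L) \<times> L) (\<lambda>((g, h), g'). {k \<in> L. fst k = fst g * fst h / fst g'})"
    have "card ?D \<le> card ?S"
    proof (rule card_inj_on_le[of "\<lambda>(y, (g', h')). ((y, g'), h')"])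
      show "finite ?S" using fin by auto
      show "(\<lambda>(y, (g', h')). ((y, g'), h')) ` ?D \<subseteq> ?S"
        using nz by (force simp: field_simps)
    qed (auto intro: inj_onI)
    also have "\<dots> = (\<Sum>((g, h), g')\<in>(L \<times> L) \<times> L. card {k \<in> L. fst k = fst g * fst h / fst g'})"
      using fin by (subst card_SigmaI) (auto simp: case_prod_beta)
    also have "\<dots> \<le> (\<Sum>_\<in>(L \<times> L) \<times> L. P)"
      by (rule sum_mono) (use P in auto)
    also have "\<dots> = card L ^ 3 * P"
      by (simp add: card_cartesian_product power3_eq_cube)
    also have "\<dots> \<le> N ^ 3 * P"
      using N by (intro mult_right_mono power_mono) auto
    finally show ?thesis .
  qed
  \<comment> \<open>The terms with \<open>y = y'\<close> are single edges, at most
    \<open>N ^ 3\<close> because three of the maps determine the fourth. The others have their base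
    pair in \<open>?D\<close> and at most \<open>M\<close> common neighbours each.\<close>
  have F: "card ?F \<le> N ^ 3 + N ^ 3 * P * M"
  proof -
    let ?F1 = "{(x, y) \<in> ?X \<times> ?X. rel x y}"
    let ?F2 = "Sigma ?D (\<lambda>(y, y'). {x \<in> ?X. rel x y \<and> rel x y'})"
    have finF1: "finite ?F1"
      by (rule finite_subset[of _ "?X \<times> ?X"]) (use fin in auto)
    have finF2: "finite ?F2"
      by (rule finite_SigmaI) (use fin finD in auto)
    have "?F \<subseteq> (\<lambda>(x, y). (x, y, y)) ` ?F1 \<union> (\<lambda>((y, y'), x). (x, y, y')) ` ?F2"
    proof
      fix z assume "z \<in> ?F"
      moreover obtain x y y' where z: "z = (x, y, y')" by (metis surj_pair)
      ultimately have xy: "x \<in> ?X" "y \<in> ?X" "y' \<in> ?X" "rel x y" "rel x y'" by auto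
      show "z \<in> (\<lambda>(x, y). (x, y, y)) ` ?F1 \<union> (\<lambda>((y, y'), x). (x, y, y')) ` ?F2"
      proof (cases "y = y'")
        case True
        then show ?thesis using xy z by auto
      next
        case False
        have "fst (fst y) * fst (snd y) = fst (fst y') * fst (snd y')"
          using slope[OF xy(1,2,4)] slope[OF xy(1,3,5)] by simp
        then have "((y, y'), x) \<in> ?F2" using xy False by auto
        then have "(\<lambda>((y, y'), x). (x, y, y')) ((y, y'), x) \<in> (\<lambda>((y, y'), x). (x, y, y')) ` ?F2"
          by (rule imageI)
        then show ?thesis unfolding z by simp
      qed
    qed
    then have "card ?F \<le> card ((\<lambda>(x, y). (x, y, y)) ` ?F1 \<union> (\<lambda>((y, y'), x). (x, y, y')) ` ?F2)"
      using finF1 finF2 by (intro card_mono) auto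
    also have "\<dots> \<le> card ((\<lambda>(x, y). (x, y, y)) ` ?F1) + card ((\<lambda>((y, y'), x). (x, y, y')) ` ?F2)"
      by (rule card_Un_le)
    also have "\<dots> \<le> card ?F1 + card ?F2"
      using finF1 finF2 by (intro add_mono card_image_le)
    also have "card ?F1 \<le> card (L \<times> (L \<times> L))"
    proof (rule card_inj_on_le[of "\<lambda>(x, y). (fst x, y)"])
      show "inj_on (\<lambda>(x, y). (fst x, y)) ?F1"
      proof (rule inj_onI)
        fix p q assume "p \<in> ?F1" "q \<in> ?F1" and eq: "(\<lambda>(x, y). (fst x, y)) p = (\<lambda>(x, y). (fst x, y)) q"
        moreover obtain g h' g' h where p: "p = ((g, h'), (g', h))" by (metis surj_pair)
        moreover obtain k' where q: "q = ((g, k'), (g', h))" using eq p by (cases q) auto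
        ultimately show "p = q" using det[of g h' g' h] det[of g k' g' h] by auto
      qed
    qed (use fin in auto)
    also have "card (L \<times> (L \<times> L)) \<le> N ^ 3"
      using power_mono[OF N, of 3] by (simp add: card_cartesian_product power3_eq_cube mult.assoc)
    also have "card ?F2 = (\<Sum>(y, y')\<in>?D. card {x \<in> ?X. rel x y \<and> rel x y'})"
      using finD fin by (subst card_SigmaI) (auto simp: case_prod_beta)
    also have "\<dots> \<le> (\<Sum>_\<in>?D. M)"
    proof (rule sum_mono)
      fix p assume "p \<in> ?D"
      then show "(case p of (y, y') \<Rightarrow> card {x \<in> ?X. rel x y \<and> rel x y'}) \<le> M"
        using share[of "fst p" "snd p"] by (simp add: case_prod_beta)
    qed
    also have "\<dots> \<le> N ^ 3 * P * M"
      using D by simp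
    finally show ?thesis by simp
  qed
  have "(real (card ?E))\<^sup>2 \<le> card ?X * real (card ?F)"
    using card_rel_square_le[of ?X ?X rel] fin by blast
  also have "\<dots> \<le> real (N * N) * real (N ^ 3 + N ^ 3 * P * M)"
    using F N by (intro mult_mono of_nat_mono) (auto simp: card_cartesian_product mult_le_mono)
  also have "\<dots> = real N ^ 5 * (1 + real M * real P)"
    by (simp add: algebra_simps eval_nat_numeral)
  finally show ?thesis unfolding E .
qed

section \<open>Slopes with many rich lines\<close>

text \<open>Elekes' sum-product argument: the solutions are counted by the squared incidences of \<open>D \<times> D'\<close> with
  the lines of slope \<open>m\<close>, and only boundedly many slopes can have many rich lines.\<close>

lemma exceptional_slopes:
  fixes \<theta> :: real
  assumes "\<theta> > 0"
  obtains K :: real where "K > 0"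
    and "\<And>D D' S :: real set. \<lbrakk>finite D; finite D'; finite S; 0 \<notin> S; \<theta> * (card D + card D') \<ge> 4\<rbrakk>
      \<Longrightarrow> card {m \<in> S. 2 * \<theta> * (card D + card D') * (card D * card D')
              < card {(z, z') \<in> (D \<times> D') \<times> (D \<times> D'). snd z - m * fst z = snd z' - m * fst z'}} \<le> K"
proof -
  from card_rich_lines_le[OF assms] obtain K :: real where K: "K > 0"
    and rich_le: "\<And>A B \<Lambda> (n::nat). \<lbrakk>finite A; finite B; finite \<Lambda>; card A + card B \<le> n; \<theta> * n \<ge> 4;
        \<And>g. g \<in> \<Lambda> \<Longrightarrow> fst g \<noteq> 0 \<and> \<theta> * n \<le> card (line_trace A B g)\<rbrakk>
      \<Longrightarrow> card \<Lambda> \<le> K * n"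
    by blast
  have "card {m \<in> S. 2 * \<theta> * (card D + card D') * (card D * card D')
      < card {(z, z') \<in> (D \<times> D') \<times> (D \<times> D'). snd z - m * fst z = snd z' - m * fst z'}} \<le> K / \<theta>"
    (is "real (card ?exc) \<le> _")
    if fin: "finite D" "finite D'" "finite S" and S: "0 \<notin> S" and n4: "\<theta> * (card D + card D') \<ge> 4"
    for D D' S :: "real set"
  proof -
    define n where "n = card D + card D'"
    let ?Z = "D \<times> D'"
    let ?I = "\<lambda>m v. card (line_trace D D' (m, v))"
    define V where "V m = (\<lambda>z. snd z - m * fst z) ` ?Z" for m
    have finV: "finite (V m)" for m unfolding V_def using fin by simp
    have I_eq: "card {z \<in> ?Z. snd z - m * fst z = v} = ?I m v" for m v
    proof (rule bij_betw_same_card[of fst])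
      show "bij_betw fst {z \<in> ?Z. snd z - m * fst z = v} (line_trace D D' (m, v))"
        unfolding bij_betw_def
      proof
        show "inj_on fst {z \<in> ?Z. snd z - m * fst z = v}"
          by (auto intro!: inj_onI simp: prod_eq_iff)
        show "fst ` {z \<in> ?Z. snd z - m * fst z = v} = line_trace D D' (m, v)"
        proof (intro equalityI subsetI)
          fix t assume "t \<in> line_trace D D' (m, v)"
          then have "(t, m * t + v) \<in> {z \<in> ?Z. snd z - m * fst z = v}" by auto
          from imageI[OF this, of fst] show "t \<in> fst ` {z \<in> ?Z. snd z - m * fst z = v}" by simp
        next
          fix t assume "t \<in> fst ` {z \<in> ?Z. snd z - m * fst z = v}"
          then obtain b where "t \<in> D" "b \<in> D'" "b - m * t = v" by auto
          moreover from this have "m * t + v = b" by simp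
          ultimately show "t \<in> line_trace D D' (m, v)" by simp
        qed
      qed
    qed
    have I_le: "?I m v \<le> card D" for m v
      using fin by (intro card_mono) auto
    have I_le': "?I m v \<le> card D'" if "m \<noteq> 0" for m v
      by (rule card_inj_on_le[of "\<lambda>t. m * t + v"]) (use fin that in \<open>auto intro: inj_onI\<close>)
    define rich where "rich m = {v \<in> V m. \<theta> * n \<le> ?I m v}" for m
    have fin_rich: "finite (rich m)" for m unfolding rich_def using finV by simp
    \<comment> \<open>The lines of slope \<open>m\<close> have \<open>card D * card D'\<close>
      incidences in all. Each incidence on a poor line contributes at most
      \<open>\<theta> * n\<close>, and each rich line at most \<open>card D * card D'\<close>; so
      more than \<open>\<theta> * n\<close> rich lines are needed to pass the threshold.\<close>
    have many: "\<theta> * n < card (rich m)" if m: "m \<in> ?exc" for m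
    proof (rule ccontr)
      assume "\<not> \<theta> * n < card (rich m)"
      then have few: "card (rich m) \<le> \<theta> * n" by simp
      have "m \<noteq> 0" using m S by auto
      have coin: "card {(z, z') \<in> ?Z \<times> ?Z. snd z - m * fst z = snd z' - m * fst z'} = (\<Sum>v\<in>V m. ?I m v * ?I m v)"
        unfolding I_eq[symmetric]
        by (rule card_coincidence_eq_sum[where f = "\<lambda>z. snd z - m * fst z" and g = "\<lambda>z. snd z - m * fst z"])
          (use fin finV in \<open>simp_all only: V_def finite_cartesian_product subset_refl\<close>)
      have "real (card {(z, z') \<in> ?Z \<times> ?Z. snd z - m * fst z = snd z' - m * fst z'})
          = (\<Sum>v\<in>V m. real (?I m v) * real (?I m v))"
        unfolding coin by simp
      also have "\<dots> \<le> (\<Sum>v\<in>V m. \<theta> * n * ?I m v + (if v \<in> rich m then real (card D * card D') else 0))"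
      proof (rule sum_mono)
        fix v assume v: "v \<in> V m"
        show "real (?I m v) * real (?I m v) \<le> \<theta> * n * ?I m v + (if v \<in> rich m then real (card D * card D') else 0)"
        proof (cases "v \<in> rich m")
          case True
          have "real (?I m v) * real (?I m v) \<le> real (card D) * real (card D')"
            using I_le I_le'[OF \<open>m \<noteq> 0\<close>] by (intro mult_mono) auto
          moreover have "0 \<le> \<theta> * n * ?I m v" using assms by simp
          ultimately show ?thesis using True by simp
        next
          case False
          then have "real (?I m v) \<le> \<theta> * n" using v by (simp add: rich_def)
          then show ?thesis using False by (simp add: mult_right_mono)
        qed
      qed
      also have "\<dots> = \<theta> * n * real (\<Sum>v\<in>V m. ?I m v) + card (rich m) * real (card D * card D')"
        using finV[of m] by (simp add: sum.distrib sum_distrib_left sum.If_cases rich_def Int_def)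
      also have "(\<Sum>v\<in>V m. ?I m v) = card D * card D'"
      proof -
        have "(\<Sum>v\<in>V m. card {z \<in> ?Z. snd z - m * fst z = v}) = card (\<Union>v\<in>V m. {z \<in> ?Z. snd z - m * fst z = v})"
          using fin finV by (intro card_UN_disjoint[symmetric]) auto
        also have "(\<Union>v\<in>V m. {z \<in> ?Z. snd z - m * fst z = v}) = ?Z" unfolding V_def by auto
        finally show ?thesis unfolding I_eq by (simp add: card_cartesian_product)
      qed
      also have "\<theta> * n * real (card D * card D') + card (rich m) * real (card D * card D')
          \<le> \<theta> * n * real (card D * card D') + \<theta> * n * real (card D * card D')"
        using few by (intro add_left_mono mult_right_mono) auto
      finally show False using m unfolding n_def by (simp add: algebra_simps)
    qed
    have fin_exc: "finite ?exc" using fin by simp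
    \<comment> \<open>Rich lines of distinct slopes are distinct, so all exceptional slopes share
      the \<open>K * n\<close> rich lines.\<close>
    have "card (Sigma ?exc rich) \<le> K * n"
    proof (rule rich_le[of D D'])
      show "finite (Sigma ?exc rich)" using fin_exc fin_rich by blast
      show "fst g \<noteq> 0 \<and> \<theta> * n \<le> card (line_trace D D' g)" if "g \<in> Sigma ?exc rich" for g
        using that S unfolding rich_def by (cases g) auto
    qed (use fin n4 in \<open>auto simp: n_def\<close>)
    moreover have "card ?exc * (\<theta> * n) \<le> real (card (Sigma ?exc rich))"
    proof -
      have "card ?exc * (\<theta> * n) \<le> (\<Sum>m\<in>?exc. real (card (rich m)))"
        using sum_bounded_below[of ?exc "\<theta> * n" "\<lambda>m. real (card (rich m))"] many by (simp add: less_imp_le)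
      then show ?thesis using fin_exc fin_rich by simp
    qed
    ultimately have "(card ?exc * \<theta>) * n \<le> K * n" by simp
    moreover have "n > 0" using n4 by (cases n) (auto simp: n_def)
    ultimately show ?thesis using assms by (simp add: field_simps)
  qed
  then show thesis using K assms that[of "K / \<theta>"] by simp
qed

text \<open>Summation goes from the innermost index outwards; a factor may depend on outer indices
  if its sum over its last index is bounded uniformly. This fits products such as
  \<open>\<rho> \<alpha> * l (\<alpha> * a) * l (a * r)\<close>.\<close>

lemma sum3_le:
  fixes f :: "'a \<Rightarrow> real" and g :: "'a \<Rightarrow> 'b \<Rightarrow> real" and h :: "'a \<Rightarrow> 'b \<Rightarrow> 'c \<Rightarrow> real"
  assumes "\<And>i. i \<in> I \<Longrightarrow> f i \<ge> 0" "\<And>i j. i \<in> I \<Longrightarrow> j \<in> J \<Longrightarrow> g i j \<ge> 0" "B \<ge> 0" "C \<ge> 0"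
    and "(\<Sum>i\<in>I. f i) \<le> A"
    and "\<And>i. i \<in> I \<Longrightarrow> (\<Sum>j\<in>J. g i j) \<le> B"
    and "\<And>i j. i \<in> I \<Longrightarrow> j \<in> J \<Longrightarrow> (\<Sum>k\<in>K. h i j k) \<le> C"
  shows "(\<Sum>i\<in>I. \<Sum>j\<in>J. \<Sum>k\<in>K. f i * g i j * h i j k) \<le> A * B * C"
proof -
  have "(\<Sum>i\<in>I. \<Sum>j\<in>J. \<Sum>k\<in>K. f i * g i j * h i j k)
      = (\<Sum>i\<in>I. f i * (\<Sum>j\<in>J. g i j * (\<Sum>k\<in>K. h i j k)))"
    by (simp add: sum_distrib_left mult.assoc)
  also have "\<dots> \<le> (\<Sum>i\<in>I. f i * (\<Sum>j\<in>J. g i j * C))"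
    by (intro sum_mono mult_left_mono) (use assms in auto)
  also have "\<dots> = (\<Sum>i\<in>I. f i * (\<Sum>j\<in>J. g i j) * C)"
    by (simp add: sum_distrib_left sum_distrib_right mult.assoc)
  also have "\<dots> \<le> (\<Sum>i\<in>I. f i * B * C)"
    by (intro sum_mono mult_left_mono mult_right_mono) (use assms in auto)
  also have "\<dots> = (\<Sum>i\<in>I. f i) * (B * C)"
    by (simp add: sum_distrib_right mult.assoc)
  also have "\<dots> \<le> A * (B * C)"
    by (intro mult_right_mono) (use assms in auto)
  finally show ?thesis by (simp add: mult.assoc)
qed

text \<open>Fibres over distinct values are disjoint. The injection \<open>\<phi>\<close> is there
  for dilates such as \<open>a \<mapsto> \<alpha> * a\<close>.\<close>

lemma sum_card_fibres_le:
  assumes "finite L" "finite V" "inj_on \<phi> V"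
  shows "(\<Sum>v\<in>V. real (card {g \<in> L. f g = \<phi> v})) \<le> card L"
proof -
  have "(\<Sum>v\<in>V. card {g \<in> L. f g = \<phi> v}) = card (\<Union>v\<in>V. {g \<in> L. f g = \<phi> v})"
    using assms by (intro card_UN_disjoint[symmetric]) (auto simp: inj_on_def)
  also have "\<dots> \<le> card L"
    using assms by (intro card_mono) auto
  finally have "real (\<Sum>v\<in>V. card {g \<in> L. f g = \<phi> v}) \<le> card L"
    by (rule of_nat_mono)
  then show ?thesis by simp
qed

section \<open>Popular quotients\<close>

text \<open>For \<open>L\<close> with nonzero slopes, the counted \<open>g\<close> correspond to the
  representations \<open>T = h \<odot> aff_inv g\<close> with \<open>g\<close> and \<open>h\<close>
  in \<open>L\<close>: these are the popular quotients. The right-hand version concerns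
  \<open>q = aff_inv g \<odot> h\<close>.\<close>

definition left_quotients :: "(real \<times> real) set \<Rightarrow> real \<Rightarrow> (real \<times> real) set" where
  "left_quotients L t = {T. fst T \<noteq> 0 \<and> t \<le> card {g \<in> L. T \<odot> g \<in> L}}"

definition right_quotients :: "(real \<times> real) set \<Rightarrow> real \<Rightarrow> (real \<times> real) set" where
  "right_quotients L t = {q. fst q \<noteq> 0 \<and> t \<le> card {g \<in> L. g \<odot> q \<in> L}}"

lemma aff_mult_left_cancel: "fst g \<noteq> 0 \<Longrightarrow> g \<odot> h = g \<odot> k \<longleftrightarrow> h = k"
  by (metis aff_mult_inv_cancel(4))

lemma aff_mult_right_cancel: "fst g \<noteq> 0 \<Longrightarrow> h \<odot> g = k \<odot> g \<longleftrightarrow> h = k"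
  by (metis aff_mult_inv_cancel(2))

text \<open>A solution \<open>h \<odot> aff_inv g = h' \<odot> aff_inv g'\<close> is rewritten with
  \<open>T = h \<odot> aff_inv g\<close> and \<open>q = aff_inv g \<odot> g'\<close>. Then
  \<open>h = T \<odot> g\<close>, \<open>g' = g \<odot> q\<close> and
  \<open>h' = T \<odot> g \<odot> q\<close>, so \<open>g\<close> is linked to \<open>T\<close> and
  to \<open>q\<close> separately.\<close>

definition triples :: "(real \<times> real) set \<Rightarrow> real \<Rightarrow> ((real \<times> real) \<times> (real \<times> real) \<times> (real \<times> real)) set" where
  "triples L t = {(T, g, q) \<in> left_quotients L t \<times> L \<times> right_quotients L t. T \<odot> g \<in> L \<and> g \<odot> q \<in> L}"

context
  fixes L :: "(real \<times> real) set" and t :: real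
  assumes fin: "finite L" and nz: "\<And>g. g \<in> L \<Longrightarrow> fst g \<noteq> 0" and t: "t > 0"
begin

lemma finite_left_quotients: "finite (left_quotients L t)"
proof (rule finite_subset)
  show "left_quotients L t \<subseteq> (\<lambda>(g, h). h \<odot> aff_inv g) ` (L \<times> L)"
  proof
    fix T assume "T \<in> left_quotients L t"
    then have "t \<le> card {g \<in> L. T \<odot> g \<in> L}" by (simp add: left_quotients_def)
    then have "{g \<in> L. T \<odot> g \<in> L} \<noteq> {}" using t by (metis card.empty not_le of_nat_0)
    then obtain g where "g \<in> L" "T \<odot> g \<in> L" by blast
    then show "T \<in> (\<lambda>(g, h). h \<odot> aff_inv g) ` (L \<times> L)"
      using nz by (intro image_eqI[of _ _ "(g, T \<odot> g)"]) auto
  qed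
qed (use fin in auto)

lemma finite_right_quotients: "finite (right_quotients L t)"
proof (rule finite_subset)
  show "right_quotients L t \<subseteq> (\<lambda>(g, h). aff_inv g \<odot> h) ` (L \<times> L)"
  proof
    fix q assume "q \<in> right_quotients L t"
    then have "t \<le> card {g \<in> L. g \<odot> q \<in> L}" by (simp add: right_quotients_def)
    then have "{g \<in> L. g \<odot> q \<in> L} \<noteq> {}" using t by (metis card.empty not_le of_nat_0)
    then obtain g where "g \<in> L" "g \<odot> q \<in> L" by blast
    then show "q \<in> (\<lambda>(g, h). aff_inv g \<odot> h) ` (L \<times> L)"
      using nz by (intro image_eqI[of _ _ "(g, g \<odot> q)"]) auto
  qed
qed (use fin in auto)

text \<open>The pair \<open>(g, T \<odot> g)\<close> determines \<open>T\<close>, so different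
  quotients use disjoint parts of \<open>L \<times> L\<close>.\<close>

lemma card_left_quotients_le: "card (left_quotients L t) * t \<le> (card L)\<^sup>2"
proof -
  let ?S = "Sigma (left_quotients L t) (\<lambda>T. {g \<in> L. T \<odot> g \<in> L})"
  have "card (left_quotients L t) * t \<le> (\<Sum>T\<in>left_quotients L t. real (card {g \<in> L. T \<odot> g \<in> L}))"
    using sum_bounded_below[of "left_quotients L t" t "\<lambda>T. real (card {g \<in> L. T \<odot> g \<in> L})"]
    by (simp add: left_quotients_def)
  also have "\<dots> = real (card ?S)"
    using fin finite_left_quotients by simp
  also have "card ?S \<le> card (L \<times> L)"
    by (rule card_inj_on_le[of "\<lambda>(T, g). (g, T \<odot> g)"])
      (use fin nz in \<open>auto intro!: inj_onI simp: aff_mult_right_cancel\<close>)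
  finally show ?thesis by (simp add: card_cartesian_product power2_eq_square)
qed

lemma card_right_quotients_le: "card (right_quotients L t) * t \<le> (card L)\<^sup>2"
proof -
  let ?S = "Sigma (right_quotients L t) (\<lambda>q. {g \<in> L. g \<odot> q \<in> L})"
  have "card (right_quotients L t) * t \<le> (\<Sum>q\<in>right_quotients L t. real (card {g \<in> L. g \<odot> q \<in> L}))"
    using sum_bounded_below[of "right_quotients L t" t "\<lambda>q. real (card {g \<in> L. g \<odot> q \<in> L})"]
    by (simp add: right_quotients_def)
  also have "\<dots> = real (card ?S)"
    using fin finite_right_quotients by simp
  also have "card ?S \<le> card (L \<times> L)"
    by (rule card_inj_on_le[of "\<lambda>(q, g). (g, g \<odot> q)"])
      (use fin nz in \<open>auto intro!: inj_onI simp: aff_mult_left_cancel\<close>)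
  finally show ?thesis by (simp add: card_cartesian_product power2_eq_square)
qed

text \<open>A slope \<open>\<alpha>\<close> is determined by \<open>g\<close> and
  \<open>\<alpha> * fst g\<close>, again a slope of \<open>L\<close>. If \<open>L\<close> has few
  slopes, then so have its popular left quotients.\<close>

lemma card_left_quotient_slopes_le:
  "card (fst ` left_quotients L t) * t \<le> card L * real (card (fst ` L))"
proof -
  let ?R = "fst ` left_quotients L t"
  let ?G = "\<lambda>\<alpha>. {g \<in> L. \<alpha> * fst g \<in> fst ` L}"
  have "t \<le> card (?G \<alpha>)" if "\<alpha> \<in> ?R" for \<alpha>
  proof -
    from that obtain T where T: "T \<in> left_quotients L t" "\<alpha> = fst T" by auto
    have "card {g \<in> L. T \<odot> g \<in> L} \<le> card (?G \<alpha>)"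
    proof (rule card_mono)
      show "{g \<in> L. T \<odot> g \<in> L} \<subseteq> ?G \<alpha>"
        unfolding T(2) by (auto simp flip: fst_aff_mult)
    qed (use fin in auto)
    then show ?thesis using T(1) by (simp add: left_quotients_def)
  qed
  then have "card ?R * t \<le> (\<Sum>\<alpha>\<in>?R. real (card (?G \<alpha>)))"
    using sum_bounded_below[of ?R t "\<lambda>\<alpha>. real (card (?G \<alpha>))"] by simp
  also have "\<dots> = real (card (Sigma ?R ?G))"
    using fin finite_left_quotients by simp
  also have "card (Sigma ?R ?G) \<le> card (L \<times> fst ` L)"
    by (rule card_inj_on_le[of "\<lambda>(\<alpha>, g). (g, \<alpha> * fst g)"])
      (use fin nz in \<open>auto intro!: inj_onI\<close>)
  finally show ?thesis by (simp add: card_cartesian_product)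
qed

lemma finite_triples: "finite (triples L t)"
  unfolding triples_def
  by (rule finite_subset[of _ "left_quotients L t \<times> L \<times> right_quotients L t"])
    (use fin finite_left_quotients finite_right_quotients in auto)

text \<open>If \<open>h \<odot> aff_inv g\<close> is unpopular, the pair \<open>(g, h)\<close>
  extends to fewer than \<open>t\<close> solutions, as \<open>g'\<close> determines
  \<open>h'\<close>. If \<open>aff_inv g \<odot> g'\<close> is unpopular, the same holds for
  \<open>(g, g')\<close>, where \<open>h\<close> determines \<open>h'\<close>.\<close>

lemma energy_le_triples: "card (energy_set L) \<le> card (triples L t) + 2 * t * (card L)\<^sup>2"
proof -
  let ?T = "\<lambda>p. snd p \<odot> aff_inv (fst p)" and ?q = "\<lambda>p. aff_inv (fst p) \<odot> snd p"
  let ?X1 = "{p \<in> L \<times> L. ?T p \<notin> left_quotients L t}"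
  let ?X2 = "{p \<in> L \<times> L. ?q p \<notin> right_quotients L t}"
  let ?B1 = "Sigma ?X1 (\<lambda>p. {g \<in> L. ?T p \<odot> g \<in> L})"
  let ?B2 = "Sigma ?X2 (\<lambda>p. {g \<in> L. g \<odot> ?q p \<in> L})"
  have q_eq: "?q (g, g') = ?q (h, h')" and h': "?T (g, h) \<odot> g' = h'" "h \<odot> ?q (g, g') = h'"
    if "((g, h), (g', h')) \<in> energy_set L" for g h g' h'
  proof -
    have L: "g \<in> L" "h \<in> L" "g' \<in> L" "h' \<in> L" "h \<odot> aff_inv g = h' \<odot> aff_inv g'"
      using that by (auto simp: energy_set_def)
    show h'1: "?T (g, h) \<odot> g' = h'"
      using L nz by simp
    show h'2: "h \<odot> ?q (g, g') = h'"
      using h'1 by (simp add: aff_mult_assoc)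
    show "?q (g, g') = ?q (h, h')"
      unfolding h'2[symmetric] using nz[OF L(2)] by simp
  qed
  let ?f = "\<lambda>((g, h), (g', h')). (?T (g, h), g, ?q (g, g'))"
  let ?f1 = "\<lambda>((g, h), (g', h')). ((g, h), g')"
  let ?f2 = "\<lambda>((g, h), (g', h')). ((g, g'), h)"
  let ?E0 = "{z \<in> energy_set L. ?f z \<in> triples L t}"
  let ?E1 = "{z \<in> energy_set L. ?f1 z \<in> ?B1}"
  let ?E2 = "{z \<in> energy_set L. ?f2 z \<in> ?B2}"
  have fins: "finite ?B1" "finite ?B2" using fin by auto
  have "energy_set L \<subseteq> ?E0 \<union> ?E1 \<union> ?E2"
  proof
    fix z assume z: "z \<in> energy_set L"
    moreover obtain g h g' h' where z_eq: "z = ((g, h), (g', h'))" by (metis surj_pair)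
    ultimately have L: "g \<in> L" "h \<in> L" "g' \<in> L" "h' \<in> L" by (auto simp: energy_set_def)
    show "z \<in> ?E0 \<union> ?E1 \<union> ?E2"
      using z L h'[OF z[unfolded z_eq]] nz unfolding z_eq by (auto simp: triples_def)
  qed
  then have "card (energy_set L) \<le> card (?E0 \<union> ?E1 \<union> ?E2)"
    using finite_energy_set[OF fin] by (intro card_mono) auto
  also have "\<dots> \<le> card ?E0 + card ?E1 + card ?E2"
    by (meson add_le_mono1 card_Un_le order_trans)
  also have "card ?E0 \<le> card (triples L t)"
  proof (rule card_inj_on_le[of ?f])
    show "inj_on ?f ?E0"
    proof (rule inj_onI)
      fix z w assume zw: "z \<in> ?E0" "w \<in> ?E0" and eq: "?f z = ?f w"
      obtain g h g' h' where z: "z = ((g, h), (g', h'))" by (metis surj_pair)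
      obtain k l k' l' where w: "w = ((k, l), (k', l'))" by (metis surj_pair)
      have "g \<in> L" "k = g" "?T (g, h) = ?T (g, l)" "?q (g, g') = ?q (g, k')"
        using eq zw unfolding z w by (auto simp: energy_set_def)
      moreover from this have "l = h" "k' = g'"
        using nz by (metis aff_mult_inv_cancel(1) fst_conv snd_conv, metis aff_mult_inv_cancel(3) fst_conv snd_conv)
      moreover have "h' = l'"
        using h'[of g h g' h'] h'[of k l k' l'] zw calculation unfolding z w by auto
      ultimately show "z = w" unfolding z w by simp
    qed
  qed (use finite_triples in auto)
  also have "card ?E1 \<le> card ?B1"
  proof (rule card_inj_on_le[of ?f1])
    show "inj_on ?f1 ?E1"
      using h'(1) by (auto intro!: inj_onI) (metis fst_conv snd_conv)+
  qed (use fins in auto)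
  also have "card ?E2 \<le> card ?B2"
  proof (rule card_inj_on_le[of ?f2])
    show "inj_on ?f2 ?E2"
      using h'(2) by (auto intro!: inj_onI) (metis fst_conv snd_conv)+
  qed (use fins in auto)
  finally have le: "card (energy_set L) \<le> card (triples L t) + card ?B1 + card ?B2" by simp
  have slope: "fst (?T p) \<noteq> 0" "fst (?q p) \<noteq> 0" if "p \<in> L \<times> L" for p
    using that nz by auto
  have "real (card ?B1) = (\<Sum>p\<in>?X1. real (card {g \<in> L. ?T p \<odot> g \<in> L}))"
    using fin by simp
  also have "\<dots> \<le> (\<Sum>p\<in>?X1. t)"
    by (rule sum_mono) (use slope in \<open>auto simp: left_quotients_def\<close>)
  also have "\<dots> \<le> real (card (L \<times> L)) * t"
    using t fin of_nat_mono[OF card_mono[of "L \<times> L" ?X1], where 'a = real]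
    by (simp add: mult_right_mono subset_iff del: card_cartesian_product of_nat_mult)
  finally have B1: "real (card ?B1) \<le> t * (card L)\<^sup>2"
    by (simp add: card_cartesian_product power2_eq_square mult_ac)
  have "real (card ?B2) = (\<Sum>p\<in>?X2. real (card {g \<in> L. g \<odot> ?q p \<in> L}))"
    using fin by simp
  also have "\<dots> \<le> (\<Sum>p\<in>?X2. t)"
    by (rule sum_mono) (use slope in \<open>auto simp: right_quotients_def\<close>)
  also have "\<dots> \<le> real (card (L \<times> L)) * t"
    using t fin of_nat_mono[OF card_mono[of "L \<times> L" ?X2], where 'a = real]
    by (simp add: mult_right_mono subset_iff del: card_cartesian_product of_nat_mult)
  finally have B2: "real (card ?B2) \<le> t * (card L)\<^sup>2"
    by (simp add: card_cartesian_product power2_eq_square mult_ac)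
  show ?thesis
    using B1 B2 of_nat_mono[OF le, where 'a = real] by simp
qed

end

text \<open>If \<open>y = g q\<close> and \<open>y' = T g\<close>, then \<open>snd y' - \<alpha> snd y = snd T - \<alpha> a snd q\<close>: the intercept of \<open>g\<close> cancels.
  So the sets \<open>D\<close> and \<open>D'\<close> in the last factor do not depend on the slope \<open>a\<close> of \<open>g\<close>.\<close>

lemma card_fibre_triples_square_le:
  fixes L :: "(real \<times> real) set" and t \<alpha> r a :: real
  assumes fin: "finite L" and nz: "\<And>g. g \<in> L \<Longrightarrow> fst g \<noteq> 0" and t: "t > 0"
  defines "F \<equiv> {z \<in> triples L t. fst (fst z) = \<alpha> \<and> fst (fst (snd z)) = a \<and> fst (snd (snd z)) = r}"
    and "R \<equiv> {T \<in> left_quotients L t. fst T = \<alpha>}"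
    and "Q \<equiv> {q \<in> right_quotients L t. fst q = r}"
    and "D \<equiv> snd ` {q \<in> right_quotients L t. fst q = r}"
    and "D' \<equiv> snd ` {T \<in> left_quotients L t. fst T = \<alpha>}"
    and "l \<equiv> card {g \<in> L. fst g = a * r}"
    and "l' \<equiv> card {g \<in> L. fst g = \<alpha> * a}"
  shows "card F \<le> card R * card Q * card {g \<in> L. fst g = a}"
    and "(real (card F))\<^sup>2 \<le> (real l * l * l')
      * real (card {(z, z') \<in> (D \<times> D') \<times> (D \<times> D'). snd z - \<alpha> * a * fst z = snd z' - \<alpha> * a * fst z'})"
proof -
  have finRQ: "finite R" "finite Q"
    using finite_left_quotients[OF fin nz t] finite_right_quotients[OF fin nz t]
    unfolding R_def Q_def by auto
  have F: "T \<in> R \<and> q \<in> Q \<and> g \<in> L \<and> fst g = a \<and> T \<odot> g \<in> L \<and> g \<odot> q \<in> L" if "(T, g, q) \<in> F" for T g q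
    using that unfolding F_def R_def Q_def triples_def by auto
  have "card F \<le> card (R \<times> (Q \<times> {g \<in> L. fst g = a}))"
    by (rule card_inj_on_le[of "\<lambda>(T, g, q). (T, q, g)"])
      (use F finRQ fin in \<open>auto intro!: inj_onI\<close>)
  then show "card F \<le> card R * card Q * card {g \<in> L. fst g = a}"
    by (simp add: card_cartesian_product mult.assoc)
  \<comment> \<open>Elements of \<open>L\<close> are collected in \<open>?X\<close> as
    \<open>(g \<odot> q, T \<odot> g)\<close> and quotients in \<open>?Y\<close> as
    \<open>(q, T)\<close>; Cauchy--Schwarz then treats the two sides separately.\<close>
  let ?X = "{g \<in> L. fst g = a * r} \<times> {g \<in> L. fst g = \<alpha> * a}"
  let ?Y = "Q \<times> R"
  let ?f = "\<lambda>x :: (real \<times> real) \<times> (real \<times> real). snd (snd x) - \<alpha> * snd (fst x)"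
  let ?g = "\<lambda>y :: (real \<times> real) \<times> (real \<times> real). snd (snd y) - \<alpha> * a * snd (fst y)"
  have finX: "finite ?X" and finY: "finite ?Y" using fin finRQ by auto
  have "card F \<le> card {(x, y) \<in> ?X \<times> ?Y. ?f x = ?g y}"
  proof (rule card_inj_on_le[of "\<lambda>(T, g, q). ((g \<odot> q, T \<odot> g), (q, T))"])
    show "inj_on (\<lambda>(T, g, q). ((g \<odot> q, T \<odot> g), (q, T))) F"
    proof (rule inj_onI)
      fix z w assume zw: "z \<in> F" "w \<in> F"
        and eq: "(\<lambda>(T, g, q). ((g \<odot> q, T \<odot> g), (q, T))) z = (\<lambda>(T, g, q). ((g \<odot> q, T \<odot> g), (q, T))) w"
      obtain T g q where z: "z = (T, g, q)" by (metis surj_pair)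
      obtain T' g' q' where w: "w = (T', g', q')" by (metis surj_pair)
      have "T' = T" "q' = q" "T \<odot> g = T \<odot> g'" using eq unfolding z w by auto
      moreover have "fst T \<noteq> 0" using F[of T g q] zw(1) unfolding z R_def left_quotients_def by auto
      ultimately show "z = w" unfolding z w by (simp add: aff_mult_left_cancel)
    qed
    show "(\<lambda>(T, g, q). ((g \<odot> q, T \<odot> g), (q, T))) ` F \<subseteq> {(x, y) \<in> ?X \<times> ?Y. ?f x = ?g y}"
    proof
      fix p assume "p \<in> (\<lambda>(T, g, q). ((g \<odot> q, T \<odot> g), (q, T))) ` F"
      then obtain T g q where z: "(T, g, q) \<in> F" and p: "p = ((g \<odot> q, T \<odot> g), (q, T))" by auto
      from F[OF z] show "p \<in> {(x, y) \<in> ?X \<times> ?Y. ?f x = ?g y}"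
        unfolding p by (auto simp: R_def Q_def aff_mult_def algebra_simps)
    qed
    show "finite {(x, y) \<in> ?X \<times> ?Y. ?f x = ?g y}"
      by (rule finite_subset[of _ "?X \<times> ?Y"]) (use finX finY in auto)
  qed
  then have "(real (card F))\<^sup>2 \<le> (real (card {(x, y) \<in> ?X \<times> ?Y. ?f x = ?g y}))\<^sup>2"
    by (intro power_mono of_nat_mono) auto
  also have "\<dots> \<le> real (card {(x, x') \<in> ?X \<times> ?X. ?f x = ?f x'}) * real (card {(y, y') \<in> ?Y \<times> ?Y. ?g y = ?g y'})"
    using card_coincidence_square_le[OF finX finY, of ?f ?g] by blast
  also have "\<dots> \<le> real (l * l * l') * real (card {(z, z') \<in> (D \<times> D') \<times> (D \<times> D'). snd z - \<alpha> * a * fst z = snd z' - \<alpha> * a * fst z'})"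
  proof (rule mult_mono)
    \<comment> \<open>In a collision, \<open>x\<close> and the first entry of \<open>x'\<close> fix
      the intercept of the second entry, whose slope is known.\<close>
    have "card {(x, x') \<in> ?X \<times> ?X. ?f x = ?f x'} \<le> card (?X \<times> {g \<in> L. fst g = a * r})"
      by (rule card_inj_on_le[of "\<lambda>(x, x'). (x, fst x')"])
        (use fin in \<open>auto intro!: inj_onI simp: prod_eq_iff\<close>)
    then have "card {(x, x') \<in> ?X \<times> ?X. ?f x = ?f x'} \<le> l * l * l'"
      by (simp add: card_cartesian_product l_def l'_def mult_ac)
    then show "real (card {(x, x') \<in> ?X \<times> ?X. ?f x = ?f x'}) \<le> real (l * l * l')"
      by (rule of_nat_mono)
    have "card {(y, y') \<in> ?Y \<times> ?Y. ?g y = ?g y'}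
        \<le> card {(z, z') \<in> (D \<times> D') \<times> (D \<times> D'). snd z - \<alpha> * a * fst z = snd z' - \<alpha> * a * fst z'}"
    proof (rule card_inj_on_le[of "\<lambda>((q, T), (q', T')). ((snd q, snd T), (snd q', snd T'))"])
      show "finite {(z, z') \<in> (D \<times> D') \<times> (D \<times> D'). snd z - \<alpha> * a * fst z = snd z' - \<alpha> * a * fst z'}"
        by (rule finite_subset[of _ "(D \<times> D') \<times> (D \<times> D')"])
          (use finRQ in \<open>auto simp: D_def D'_def R_def Q_def\<close>)
    qed (auto intro!: inj_onI simp: D_def D'_def R_def Q_def prod_eq_iff)
    then show "real (card {(y, y') \<in> ?Y \<times> ?Y. ?g y = ?g y'})
        \<le> real (card {(z, z') \<in> (D \<times> D') \<times> (D \<times> D'). snd z - \<alpha> * a * fst z = snd z' - \<alpha> * a * fst z'})"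
      by (rule of_nat_mono)
  qed auto
  finally show "(real (card F))\<^sup>2 \<le> (real l * l * l')
      * real (card {(z, z') \<in> (D \<times> D') \<times> (D \<times> D'). snd z - \<alpha> * a * fst z = snd z' - \<alpha> * a * fst z'})"
    by simp
qed

text \<open>The right-hand side is a sum of products of three of the four sizes because these, unlike the product of
  all four, can be summed over the three slopes.\<close>

lemma le_sum_of_triple_products:
  fixes x l l' p q E \<eta> :: real
  assumes "x\<^sup>2 \<le> (l * l * l') * E" "E \<le> \<eta>\<^sup>2 * (p + q) * (p * q)"
    and pos: "l \<ge> 0" "l' \<ge> 0" "p \<ge> 0" "q \<ge> 0" "\<eta> \<ge> 0"
  shows "x \<le> \<eta> / 2 * (p * q * l + p * q * l' + p * l' * l + q * l * l')"
proof -
  let ?u = "p * q * (l + l')" and ?v = "l * l' * (p + q)"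
  have "x\<^sup>2 \<le> (l * l * l') * (\<eta>\<^sup>2 * (p + q) * (p * q))"
    using assms(1) mult_left_mono[OF assms(2), of "l * l * l'"] pos by simp
  \<comment> \<open>A further nonnegative term completes the expression to a product of two sums, to
    which the inequality of arithmetic and geometric means applies.\<close>
  also have "\<dots> \<le> \<eta>\<^sup>2 * (?u * ?v)"
  proof -
    have "0 \<le> \<eta>\<^sup>2 * (p * q * l' * (l * l' * (p + q)))" using pos by simp
    then show ?thesis by (simp add: algebra_simps)
  qed
  also have "\<dots> \<le> \<eta>\<^sup>2 * ((?u + ?v) / 2)\<^sup>2"
  proof (rule mult_left_mono)
    have "0 \<le> (?u - ?v)\<^sup>2" by simp
    then show "?u * ?v \<le> ((?u + ?v) / 2)\<^sup>2"
      by (simp only: power2_eq_square) (simp add: field_simps)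
  qed simp
  also have "\<dots> = (\<eta> * ((?u + ?v) / 2))\<^sup>2" by (simp only: power_mult_distrib)
  finally have "x \<le> \<eta> * ((?u + ?v) / 2)"
    by (rule power2_le_imp_le) (use pos in simp)
  then show ?thesis by (simp add: algebra_simps)
qed

section \<open>Energy when every slope occurs often\<close>

text \<open>Triples are sorted by the slopes \<open>\<alpha>\<close>, \<open>r\<close>,
  \<open>a\<close> of \<open>T\<close>, \<open>q\<close>, \<open>g\<close>. Generic slopes obey the
  sum of triple products. For given \<open>\<alpha>\<close> and \<open>r\<close> with a large class
  of \<open>\<alpha>\<close>, at most \<open>K\<close> slopes \<open>a\<close> are exceptional, and
  each has at most \<open>\<epsilon> * N\<close> maps. Slopes \<open>\<alpha>\<close> with small
  classes are harmless because \<open>L\<close>, having large slope classes, has few slopes.\<close>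

lemma energy_large_fibres:
  fixes e :: real
  assumes e: "e > 0"
  obtains P :: nat and \<epsilon> :: real where "\<epsilon> > 0"
    and "\<And>L N. \<lbrakk>finite L; card L \<le> N; \<And>g. g \<in> L \<Longrightarrow> fst g \<noteq> 0;
        \<And>g. g \<in> L \<Longrightarrow> P \<le> card {h \<in> L. fst h = fst g};
        \<And>a. card {h \<in> L. fst h = a} \<le> \<epsilon> * real N\<rbrakk>
      \<Longrightarrow> card (energy_set L) \<le> 3 / 4 * e * real N ^ 3"
proof -
  \<comment> \<open>By \<open>\<delta> \<le> e / 8\<close> the unpopular quotients cost at most
    \<open>e / 4 * N ^ 3\<close>. The choices of \<open>\<eta>\<close>, \<open>P\<close> and
    \<open>\<epsilon>\<close> bring each of four contributions to the triples down to
    \<open>e / 8 * N ^ 3\<close>, and \<open>2 * \<theta> = \<eta>\<^sup>2\<close> fits the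
    hypothesis of \<open>le_sum_of_triple_products\<close>.\<close>
  define \<delta> where "\<delta> = min (e / 8) 1"
  define \<eta> where "\<eta> = e * \<delta>\<^sup>2 / 8"
  define \<theta> where "\<theta> = \<eta>\<^sup>2 / 2"
  have \<delta>: "\<delta> > 0" "\<delta> \<le> 1" "\<delta> \<le> e / 8" using e by (auto simp: \<delta>_def)
  have \<eta>: "\<eta> > 0" using e \<delta> by (simp add: \<eta>_def)
  have \<theta>: "\<theta> > 0" using \<eta> by (simp add: \<theta>_def)
  from exceptional_slopes[OF this] obtain K :: real where K: "K > 0"
    and exc_le: "\<And>D D' S :: real set. \<lbrakk>finite D; finite D'; finite S; 0 \<notin> S; \<theta> * (card D + card D') \<ge> 4\<rbrakk>
      \<Longrightarrow> card {m \<in> S. 2 * \<theta> * (card D + card D') * (card D * card D')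
              < card {(z, z') \<in> (D \<times> D') \<times> (D \<times> D'). snd z - m * fst z = snd z' - m * fst z'}} \<le> K"
    by blast
  \<comment> \<open>From \<open>P'\<close> elements on, a class of left quotients meets the
    condition \<open>\<theta> * (card D + card D') \<ge> 4\<close>.\<close>
  define P' where "P' = 4 / \<theta>"
  define P where "P = nat \<lceil>8 * P' / (e * \<delta>\<^sup>2)\<rceil>"
  define \<epsilon> where "\<epsilon> = e * \<delta>\<^sup>2 / (8 * K)"
  have P': "P' > 0" using \<theta> by (simp add: P'_def)
  have P: "P \<ge> 8 * P' / (e * \<delta>\<^sup>2)" unfolding P_def by (rule of_nat_ceiling)
  have "8 * P' / (e * \<delta>\<^sup>2) > 0" using e \<delta> P' by simp
  then have P0: "real P > 0" using P by linarith
  have \<epsilon>: "\<epsilon> > 0" using e \<delta> K by (simp add: \<epsilon>_def)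
  have "card (energy_set L) \<le> 3 / 4 * e * real N ^ 3"
    if fin: "finite L" and N: "card L \<le> N" and nz: "\<And>g. g \<in> L \<Longrightarrow> fst g \<noteq> 0"
      and large: "\<And>g. g \<in> L \<Longrightarrow> P \<le> card {h \<in> L. fst h = fst g}"
      and small: "\<And>a. card {h \<in> L. fst h = a} \<le> \<epsilon> * real N"
    for L N
  proof (cases "N = 0")
    case True
    then have "L = {}" using N fin by simp
    then have "energy_set L = {}" by (simp add: energy_set_def)
    then show ?thesis using e by simp
  next
    case N0: False
    define t where "t = \<delta> * N"
    have t: "t > 0" using \<delta> N0 by (simp add: t_def)
    define R Q where "R = left_quotients L t" and "Q = right_quotients L t"
    define R' Q' S where "R' = fst ` R" and "Q' = fst ` Q" and "S = fst ` L"
    define \<rho> where "\<rho> \<alpha> = real (card {T \<in> R. fst T = \<alpha>})" for \<alpha>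
    define \<kappa> where "\<kappa> r = real (card {q \<in> Q. fst q = r})" for r
    define l where "l a = real (card {g \<in> L. fst g = a})" for a
    have finR: "finite R" and finQ: "finite Q"
      unfolding R_def Q_def using finite_left_quotients[OF fin nz t] finite_right_quotients[OF fin nz t] by auto
    have fin': "finite R'" "finite Q'" "finite S" using finR finQ fin by (auto simp: R'_def Q'_def S_def)
    have nz': "\<alpha> \<noteq> 0" if "\<alpha> \<in> R'" for \<alpha> using that by (auto simp: R'_def R_def left_quotients_def)
    have nz'': "r \<noteq> 0" if "r \<in> Q'" for r using that by (auto simp: Q'_def Q_def right_quotients_def)
    have nzS: "a \<noteq> 0" if "a \<in> S" for a using that nz by (auto simp: S_def)
    have [simp]: "\<rho> \<alpha> \<ge> 0" "\<kappa> r \<ge> 0" "l a \<ge> 0" for \<alpha> r a by (auto simp: \<rho>_def \<kappa>_def l_def)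
    have NN: "(card L)\<^sup>2 \<le> (real N)\<^sup>2" using N by simp
    have "real (card R) * t \<le> (real N)\<^sup>2"
      using card_left_quotients_le[OF fin nz t] NN unfolding R_def by linarith
    then have R: "card R \<le> N / \<delta>"
      using N0 \<delta> by (simp add: t_def field_simps power2_eq_square)
    have "real (card Q) * t \<le> (real N)\<^sup>2"
      using card_right_quotients_le[OF fin nz t] NN unfolding Q_def by linarith
    then have Q: "card Q \<le> N / \<delta>"
      using N0 \<delta> by (simp add: t_def field_simps power2_eq_square)
    have sum_\<rho>: "(\<Sum>\<alpha>\<in>R'. \<rho> \<alpha>) \<le> N / \<delta>"
      using sum_card_fibres_le[OF finR fin'(1), of "\<lambda>x. x" fst] R unfolding \<rho>_def by simp
    have sum_\<kappa>: "(\<Sum>r\<in>Q'. \<kappa> r) \<le> N / \<delta>"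
      using sum_card_fibres_le[OF finQ fin'(2), of "\<lambda>x. x" fst] Q unfolding \<kappa>_def by simp
    have sum_l: "(\<Sum>v\<in>V. l (\<phi> v)) \<le> N" if "finite V" "inj_on \<phi> V" for V and \<phi> :: "real \<Rightarrow> real"
      using sum_card_fibres_le[OF fin that, of fst] N unfolding l_def by simp
    \<comment> \<open>Classes of size at least \<open>P\<close> leave at most \<open>N / P\<close>
      slopes in \<open>L\<close>, hence at most \<open>N / (\<delta> * P)\<close> slopes of popular
      left quotients.\<close>
    have "card S * real P \<le> (\<Sum>a\<in>S. l a)"
    proof -
      have "real P \<le> l a" if "a \<in> S" for a using that large by (auto simp: S_def l_def)
      from sum_bounded_below[of S, OF this] show ?thesis by simp
    qed
    also have "\<dots> \<le> N" using sum_l[of S "\<lambda>x. x"] fin' by simp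
    finally have "card S * real P \<le> N" .
    moreover have "card R' * t \<le> card L * real (card S)"
      using card_left_quotient_slopes_le[OF fin nz t] unfolding R'_def R_def S_def .
    then have "card R' * t \<le> N * real (card S)"
      using N by (meson mult_right_mono of_nat_0_le_iff of_nat_le_iff order_trans)
    then have "card R' * \<delta> \<le> card S" using N0 by (simp add: t_def)
    then have "card R' * \<delta> * P \<le> card S * real P" by (rule mult_right_mono) simp
    ultimately have "card R' * \<delta> * P \<le> N" by linarith
    then have R': "card R' \<le> N / (\<delta> * P)" using \<delta> P0 by (simp add: field_simps)
    define F where "F \<alpha> r a = {z \<in> triples L t. fst (fst z) = \<alpha> \<and> fst (fst (snd z)) = a \<and> fst (snd (snd z)) = r}" for \<alpha> r a
    define D where "D r = snd ` {q \<in> Q. fst q = r}" for r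
    define D' where "D' \<alpha> = snd ` {T \<in> R. fst T = \<alpha>}" for \<alpha>
    define E2 where "E2 \<alpha> r m = card {(z, z') \<in> (D r \<times> D' \<alpha>) \<times> (D r \<times> D' \<alpha>). snd z - m * fst z = snd z' - m * fst z'}" for \<alpha> r m
    define exc where "exc \<alpha> r = {a \<in> S. \<eta>\<^sup>2 * (\<rho> \<alpha> + \<kappa> r) * (\<rho> \<alpha> * \<kappa> r) < E2 \<alpha> r (\<alpha> * a)}" for \<alpha> r
    define h where "h \<alpha> r a = (if \<rho> \<alpha> \<ge> P' \<and> a \<in> exc \<alpha> r then l a else 0)" for \<alpha> r a
    have cardD: "real (card (D r)) = \<kappa> r" for r
      unfolding D_def \<kappa>_def by (subst card_image) (auto intro!: inj_onI simp: prod_eq_iff)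
    have cardD': "real (card (D' \<alpha>)) = \<rho> \<alpha>" for \<alpha>
      unfolding D'_def \<rho>_def by (subst card_image) (auto intro!: inj_onI simp: prod_eq_iff)
    have sum_h: "(\<Sum>a\<in>S. h \<alpha> r a) \<le> K * (\<epsilon> * N)" if "\<alpha> \<in> R'" "r \<in> Q'" for \<alpha> r
    proof (cases "\<rho> \<alpha> \<ge> P'")
      case True
      then have "\<theta> * \<rho> \<alpha> \<ge> 4" using \<theta> by (simp add: P'_def field_simps)
      moreover have "\<theta> * \<kappa> r \<ge> 0" using \<theta> by simp
      ultimately have "\<theta> * real (card (D r) + card (D' \<alpha>)) \<ge> 4"
        by (simp add: cardD cardD' distrib_left)
      then have "real (card {m \<in> (\<lambda>a. \<alpha> * a) ` S. 2 * \<theta> * (card (D r) + card (D' \<alpha>)) * (card (D r) * card (D' \<alpha>))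
              < E2 \<alpha> r m}) \<le> K"
        unfolding E2_def
        by (intro exc_le) (use fin' nzS nz'[OF that(1)] finR finQ in \<open>auto simp: D_def D'_def\<close>)
      moreover have "card (exc \<alpha> r) \<le> card {m \<in> (\<lambda>a. \<alpha> * a) ` S. 2 * \<theta> * (card (D r) + card (D' \<alpha>)) * (card (D r) * card (D' \<alpha>))
              < E2 \<alpha> r m}"
      proof (rule card_inj_on_le[of "\<lambda>a. \<alpha> * a"])
        show "(\<lambda>a. \<alpha> * a) ` exc \<alpha> r \<subseteq> {m \<in> (\<lambda>a. \<alpha> * a) ` S. 2 * \<theta> * (card (D r) + card (D' \<alpha>)) * (card (D r) * card (D' \<alpha>))
              < E2 \<alpha> r m}"
          by (auto simp: exc_def cardD cardD' \<theta>_def add.commute mult.commute)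
      qed (use fin' nz'[OF that(1)] in \<open>auto intro: inj_onI\<close>)
      ultimately have "card (exc \<alpha> r) \<le> K" by linarith
      have "(\<Sum>a\<in>S. h \<alpha> r a) = (\<Sum>a\<in>exc \<alpha> r. l a)"
        using True fin' by (intro sum.mono_neutral_cong_right) (auto simp: h_def exc_def)
      also have "\<dots> \<le> (\<Sum>a\<in>exc \<alpha> r. \<epsilon> * N)"
        by (rule sum_mono) (use small in \<open>simp add: l_def\<close>)
      also have "\<dots> \<le> K * (\<epsilon> * N)"
        using \<open>card (exc \<alpha> r) \<le> K\<close> \<epsilon> by (simp add: mult_right_mono)
      finally show ?thesis .
    next
      case False
      then show ?thesis using K \<epsilon> by (simp add: h_def)
    qed
    \<comment> \<open>\<open>?A\<close> pays for small classes of left quotients and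
      \<open>?B\<close> for exceptional slopes, both by the trivial bound
      \<open>\<rho> \<alpha> * \<kappa> r * l a\<close>; \<open>?C\<close> pays for the generic
      case.\<close>
    have pointwise: "real (card (F \<alpha> r a)) \<le> (if \<rho> \<alpha> < P' then \<rho> \<alpha> else 0) * \<kappa> r * l a + \<rho> \<alpha> * \<kappa> r * h \<alpha> r a
        + \<eta> / 2 * (\<rho> \<alpha> * \<kappa> r * l (a * r) + \<rho> \<alpha> * \<kappa> r * l (\<alpha> * a) + \<rho> \<alpha> * l (\<alpha> * a) * l (a * r) + \<kappa> r * l (a * r) * l (\<alpha> * a))"
      (is "_ \<le> ?A + ?B + ?C")
      if "\<alpha> \<in> R'" "r \<in> Q'" "a \<in> S" for \<alpha> r a
    proof -
      note fib = card_fibre_triples_square_le[OF fin nz t, of \<alpha> a r]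
      have nn: "?A \<ge> 0" "?B \<ge> 0" "?C \<ge> 0" using \<eta> by (auto simp: h_def)
      have triv: "real (card (F \<alpha> r a)) \<le> \<rho> \<alpha> * \<kappa> r * l a"
        using of_nat_mono[OF fib(1), where 'a = real] unfolding F_def \<rho>_def \<kappa>_def l_def R_def Q_def by simp
      show ?thesis
      proof (cases "\<rho> \<alpha> < P' \<or> a \<in> exc \<alpha> r")
        case True
        then show ?thesis using triv nn by (auto simp: h_def split: if_splits)
      next
        case False
        then have "E2 \<alpha> r (\<alpha> * a) \<le> \<eta>\<^sup>2 * (\<rho> \<alpha> + \<kappa> r) * (\<rho> \<alpha> * \<kappa> r)"
          using that by (auto simp: exc_def)
        moreover have "(real (card (F \<alpha> r a)))\<^sup>2 \<le> (l (a * r) * l (a * r) * l (\<alpha> * a)) * E2 \<alpha> r (\<alpha> * a)"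
          using fib(2) unfolding F_def l_def E2_def D_def D'_def R_def Q_def .
        ultimately have "real (card (F \<alpha> r a)) \<le> ?C"
          using le_sum_of_triple_products[of "real (card (F \<alpha> r a))" "l (a * r)" "l (\<alpha> * a)" "E2 \<alpha> r (\<alpha> * a)" \<eta> "\<rho> \<alpha>" "\<kappa> r"] \<eta>
          by simp
        then show ?thesis using nn by linarith
      qed
    qed
    have "real (card (triples L t)) = (\<Sum>\<alpha>\<in>R'. \<Sum>r\<in>Q'. \<Sum>a\<in>S. real (card (F \<alpha> r a)))"
    proof -
      let ?F = "\<lambda>z :: (real \<times> real) \<times> (real \<times> real) \<times> (real \<times> real). (fst (fst z), fst (snd (snd z)), fst (fst (snd z)))"
      have "card (triples L t) = (\<Sum>p\<in>R' \<times> Q' \<times> S. card {z \<in> triples L t. ?F z = p})"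
      proof -
        have "?F ` triples L t \<subseteq> R' \<times> Q' \<times> S"
          by (auto simp: triples_def R'_def Q'_def S_def R_def Q_def)
        then show ?thesis
          using sum.group[of "triples L t" "R' \<times> Q' \<times> S" ?F "\<lambda>_. 1::nat"] finite_triples[OF fin nz t] fin'
          by simp
      qed
      also have "\<dots> = (\<Sum>(\<alpha>, r, a)\<in>R' \<times> Q' \<times> S. card (F \<alpha> r a))"
        by (intro sum.cong refl) (auto simp: F_def intro!: arg_cong[of _ _ card])
      finally show ?thesis
        using fin' by (simp add: sum.cartesian_product case_prod_beta)
    qed
    also have "\<dots> \<le> (\<Sum>\<alpha>\<in>R'. \<Sum>r\<in>Q'. \<Sum>a\<in>S. (if \<rho> \<alpha> < P' then \<rho> \<alpha> else 0) * \<kappa> r * l a + \<rho> \<alpha> * \<kappa> r * h \<alpha> r a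
        + \<eta> / 2 * (\<rho> \<alpha> * \<kappa> r * l (a * r) + \<rho> \<alpha> * \<kappa> r * l (\<alpha> * a) + \<rho> \<alpha> * l (\<alpha> * a) * l (a * r) + \<kappa> r * l (a * r) * l (\<alpha> * a)))"
      by (intro sum_mono pointwise)
    also have "\<dots> = (\<Sum>\<alpha>\<in>R'. \<Sum>r\<in>Q'. \<Sum>a\<in>S. (if \<rho> \<alpha> < P' then \<rho> \<alpha> else 0) * \<kappa> r * l a)
        + (\<Sum>\<alpha>\<in>R'. \<Sum>r\<in>Q'. \<Sum>a\<in>S. \<rho> \<alpha> * \<kappa> r * h \<alpha> r a)
        + \<eta> / 2 * ((\<Sum>\<alpha>\<in>R'. \<Sum>r\<in>Q'. \<Sum>a\<in>S. \<rho> \<alpha> * \<kappa> r * l (a * r))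
          + (\<Sum>\<alpha>\<in>R'. \<Sum>r\<in>Q'. \<Sum>a\<in>S. \<rho> \<alpha> * \<kappa> r * l (\<alpha> * a))
          + (\<Sum>\<alpha>\<in>R'. \<Sum>r\<in>Q'. \<Sum>a\<in>S. \<rho> \<alpha> * l (\<alpha> * a) * l (a * r))
          + (\<Sum>\<alpha>\<in>R'. \<Sum>r\<in>Q'. \<Sum>a\<in>S. \<kappa> r * l (a * r) * l (\<alpha> * a)))"
      by (simp only: sum.distrib sum_distrib_left distrib_left)
    also have "\<dots> \<le> (N / (\<delta> * P) * P') * (N / \<delta>) * N + (N / \<delta>) * (N / \<delta>) * (K * (\<epsilon> * N))
        + \<eta> / 2 * ((N / \<delta>) * (N / \<delta>) * N + (N / \<delta>) * (N / \<delta>) * N + (N / \<delta>) * N * N + (N / \<delta>) * N * N)"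
    proof (intro add_mono mult_left_mono)
      have inj_mult: "inj_on (\<lambda>x. c * x) V" "inj_on (\<lambda>x. x * c) V" if "c \<noteq> 0" for c :: real and V
        using that by (auto intro: inj_onI)
      show "(\<Sum>\<alpha>\<in>R'. \<Sum>r\<in>Q'. \<Sum>a\<in>S. (if \<rho> \<alpha> < P' then \<rho> \<alpha> else 0) * \<kappa> r * l a) \<le> (N / (\<delta> * P) * P') * (N / \<delta>) * N"
      proof (rule sum3_le)
        have "(\<Sum>\<alpha>\<in>R'. if \<rho> \<alpha> < P' then \<rho> \<alpha> else 0) \<le> (\<Sum>\<alpha>\<in>R'. P')"
          by (rule sum_mono) (use P' in auto)
        also have "\<dots> \<le> N / (\<delta> * P) * P'"
          using mult_right_mono[OF R', of P'] P' by simp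
        finally show "(\<Sum>\<alpha>\<in>R'. if \<rho> \<alpha> < P' then \<rho> \<alpha> else 0) \<le> N / (\<delta> * P) * P'" .
      qed (use sum_\<kappa> sum_l[of S "\<lambda>x. x"] fin' \<delta> in auto)
      show "(\<Sum>\<alpha>\<in>R'. \<Sum>r\<in>Q'. \<Sum>a\<in>S. \<rho> \<alpha> * \<kappa> r * h \<alpha> r a) \<le> (N / \<delta>) * (N / \<delta>) * (K * (\<epsilon> * N))"
        by (rule sum3_le) (use sum_\<rho> sum_\<kappa> sum_h \<delta> K \<epsilon> in auto)
      show "(\<Sum>\<alpha>\<in>R'. \<Sum>r\<in>Q'. \<Sum>a\<in>S. \<rho> \<alpha> * \<kappa> r * l (a * r)) \<le> (N / \<delta>) * (N / \<delta>) * N"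
        by (rule sum3_le) (use sum_\<rho> sum_\<kappa> sum_l[OF _ inj_mult(2)] nz'' fin' \<delta> in auto)
      show "(\<Sum>\<alpha>\<in>R'. \<Sum>r\<in>Q'. \<Sum>a\<in>S. \<rho> \<alpha> * \<kappa> r * l (\<alpha> * a)) \<le> (N / \<delta>) * (N / \<delta>) * N"
        by (rule sum3_le) (use sum_\<rho> sum_\<kappa> sum_l[OF _ inj_mult(1)] nz' fin' \<delta> in auto)
      \<comment> \<open>The sums are reordered so that each factor is summed over an index in which
        its argument is injective: here \<open>l (\<alpha> * a)\<close> over \<open>a\<close>, and
        \<open>l (a * r)\<close> over \<open>r\<close>.\<close>
      have "(\<Sum>\<alpha>\<in>R'. \<Sum>r\<in>Q'. \<Sum>a\<in>S. \<rho> \<alpha> * l (\<alpha> * a) * l (a * r)) = (\<Sum>\<alpha>\<in>R'. \<Sum>a\<in>S. \<Sum>r\<in>Q'. \<rho> \<alpha> * l (\<alpha> * a) * l (a * r))"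
        by (intro sum.cong refl sum.swap)
      also have "\<dots> \<le> (N / \<delta>) * N * N"
        by (rule sum3_le) (use sum_\<rho> sum_l[OF _ inj_mult(1)] nz' nzS fin' \<delta> in auto)
      finally show "(\<Sum>\<alpha>\<in>R'. \<Sum>r\<in>Q'. \<Sum>a\<in>S. \<rho> \<alpha> * l (\<alpha> * a) * l (a * r)) \<le> (N / \<delta>) * N * N" .
      have "(\<Sum>\<alpha>\<in>R'. \<Sum>r\<in>Q'. \<Sum>a\<in>S. \<kappa> r * l (a * r) * l (\<alpha> * a)) = (\<Sum>r\<in>Q'. \<Sum>a\<in>S. \<Sum>\<alpha>\<in>R'. \<kappa> r * l (a * r) * l (\<alpha> * a))"
        by (subst sum.swap) (intro sum.cong refl sum.swap)
      also have "\<dots> \<le> (N / \<delta>) * N * N"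
        by (rule sum3_le) (use sum_\<kappa> sum_l[OF _ inj_mult(2)] nz'' nzS fin' \<delta> in auto)
      finally show "(\<Sum>\<alpha>\<in>R'. \<Sum>r\<in>Q'. \<Sum>a\<in>S. \<kappa> r * l (a * r) * l (\<alpha> * a)) \<le> (N / \<delta>) * N * N" .
    qed (use \<eta> in simp)
    also have "\<dots> = real N ^ 3 * (P' / P / \<delta>\<^sup>2 + K * \<epsilon> / \<delta>\<^sup>2 + \<eta> / \<delta>\<^sup>2 + \<eta> / \<delta>)"
      using \<delta> P0 by (simp add: field_simps power2_eq_square power3_eq_cube)
    also have "\<dots> \<le> real N ^ 3 * (e / 8 + e / 8 + e / 8 + e / 8)"
    proof (intro mult_left_mono add_mono)
      have "8 * P' / (e * \<delta>\<^sup>2) \<le> P" by (rule P)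
      then have "8 * P' \<le> P * (e * \<delta>\<^sup>2)" using e \<delta> by (simp add: pos_divide_le_eq)
      then show "P' / P / \<delta>\<^sup>2 \<le> e / 8" using P0 \<delta> by (simp add: field_simps)
      show "K * \<epsilon> / \<delta>\<^sup>2 \<le> e / 8" using K \<delta> by (simp add: \<epsilon>_def)
      show "\<eta> / \<delta>\<^sup>2 \<le> e / 8" using \<delta> by (simp add: \<eta>_def)
      have "\<eta> / \<delta> = e / 8 * \<delta>" using \<delta> by (simp add: \<eta>_def power2_eq_square)
      then show "\<eta> / \<delta> \<le> e / 8" using \<delta> e by simp
    qed simp
    finally have tr: "real (card (triples L t)) \<le> e / 2 * real N ^ 3" by (simp add: mult.commute)
    have "2 * t * (card L)\<^sup>2 \<le> 2 * t * (real N)\<^sup>2"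
      using NN t by (intro mult_left_mono) auto
    also have "\<dots> \<le> 2 * (e / 8 * N) * (real N)\<^sup>2"
      using \<delta> unfolding t_def by (intro mult_right_mono mult_left_mono) auto
    also have "\<dots> = e / 4 * real N ^ 3" by (simp add: power2_eq_square power3_eq_cube)
    finally show ?thesis
      using energy_le_triples[OF fin nz t] tr by (simp add: algebra_simps)
  qed
  then show thesis using \<epsilon> by (intro that[of \<epsilon> P]) auto
qed

section \<open>From many incidences to a line in the coefficient plane\<close>

text \<open>The maps are split according to whether at least \<open>P\<close> of them share the
  slope. One part keeps half of the incidences, which is why the energy bound is taken for
  \<open>c / 2\<close>.\<close>

lemma rich_affine_maps_collinear:
  fixes c :: real
  assumes c: "c > 0"
  shows "\<exists>c'::real. c' > 0 \<and> (\<forall>A B (L :: (real \<times> real) set) N. finite A \<longrightarrow> finite B \<longrightarrow> finite L \<longrightarrow> N \<ge> 1 \<longrightarrow>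
      card A \<le> N \<longrightarrow> card B \<le> N \<longrightarrow> card L \<le> N \<longrightarrow> (\<forall>g\<in>L. fst g \<noteq> 0) \<longrightarrow>
      c * (real N)\<^sup>2 \<le> card {(x, g) \<in> A \<times> L. fst g * x + snd g \<in> B} \<longrightarrow>
      (\<exists>u v w. (u, v) \<noteq> (0 :: real, 0 :: real) \<and> c' * N \<le> card {g \<in> L. u * fst g + v * snd g = w}))"
proof -
  have "c / 2 > 0" using c by simp
  from energy_ge[OF this] obtain e :: real where e: "e > 0"
    and e_le: "\<And>A B L N. \<lbrakk>finite A; finite B; finite L; card A \<le> N; card B \<le> N; card L \<le> N;
        \<And>g. g \<in> L \<Longrightarrow> fst g \<noteq> 0;
        c / 2 * (real N)\<^sup>2 \<le> card {(x, g) \<in> A \<times> L. fst g * x + snd g \<in> B}\<rbrakk>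
      \<Longrightarrow> e * real N ^ 3 \<le> card (energy_set L)"
    by blast
  obtain P :: nat and \<epsilon> :: real where \<epsilon>: "\<epsilon> > 0"
    and large: "\<And>L N. \<lbrakk>finite L; card L \<le> N; \<And>g. g \<in> L \<Longrightarrow> fst g \<noteq> 0;
        \<And>g. g \<in> L \<Longrightarrow> P \<le> card {h \<in> L. fst h = fst g};
        \<And>a. card {h \<in> L. fst h = a} \<le> \<epsilon> * real N\<rbrakk>
      \<Longrightarrow> card (energy_set L) \<le> 3 / 4 * e * real N ^ 3"
  proof (rule energy_large_fibres[OF e], goal_cases)
    case (1 P \<epsilon>)
    show thesis by (rule that[of \<epsilon> P, OF 1(2)], rule 1(3)) simp_all
  qed
  \<comment> \<open>Large slope classes call for \<open>c' \<le> \<epsilon>\<close>; for small ones,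
    the second term brings the bound for the squared energy down to
    \<open>e\<^sup>2 / 2 * N ^ 6\<close>.\<close>
  define c' where "c' = min \<epsilon> (e\<^sup>2 / (2 * (1 + real P)))"
  have c': "c' > 0" "c' \<le> \<epsilon>" "c' * (1 + real P) \<le> e\<^sup>2 / 2"
  proof -
    show "c' > 0" "c' \<le> \<epsilon>" using e \<epsilon> by (auto simp: c'_def intro!: divide_pos_pos add_pos_nonneg)
    have "c' \<le> e\<^sup>2 / (2 * (1 + real P))" by (simp add: c'_def)
    then show "c' * (1 + real P) \<le> e\<^sup>2 / 2" by (simp add: field_simps)
  qed
  have main: "\<exists>u v w. (u, v) \<noteq> (0 :: real, 0 :: real) \<and> c' * N \<le> card {g \<in> L. u * fst g + v * snd g = w}"
    if fin: "finite A" "finite B" "finite L" and N: "N \<ge> 1" "card A \<le> N" "card B \<le> N" "card L \<le> N"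
      and nz: "\<And>g. g \<in> L \<Longrightarrow> fst g \<noteq> 0"
      and inc: "c * (real N)\<^sup>2 \<le> card {(x, g) \<in> A \<times> L. fst g * x + snd g \<in> B}"
    for A B N and L :: "(real \<times> real) set"
  proof (rule ccontr)
    assume "\<not> (\<exists>u v w. (u, v) \<noteq> (0, 0) \<and> c' * N \<le> card {g \<in> L. u * fst g + v * snd g = w})"
    then have poor: "card {g \<in> L. u * fst g + v * snd g = w} < c' * N" if "(u, v) \<noteq> (0, 0)" for u v w
      using that by (meson not_le)
    have fibre: "card {g \<in> L. fst g = a} < c' * N" for a
      using poor[of 1 0 a] by simp
    define L1 where "L1 = {g \<in> L. P \<le> card {h \<in> L. fst h = fst g}}"
    define L2 where "L2 = {g \<in> L. \<not> P \<le> card {h \<in> L. fst h = fst g}}"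
    have L12: "L1 \<subseteq> L" "L2 \<subseteq> L" by (auto simp: L1_def L2_def)
    have fin12: "finite L1" "finite L2" using L12 fin by (auto intro: finite_subset)
    have card12: "card L1 \<le> N" "card L2 \<le> N"
      using card_mono[OF fin(3) L12(1)] card_mono[OF fin(3) L12(2)] N by auto
    have nz12: "g \<in> L1 \<Longrightarrow> fst g \<noteq> 0" "g \<in> L2 \<Longrightarrow> fst g \<noteq> 0" for g
      using L12 nz[of g] by auto
    let ?I = "\<lambda>L. {(x, g) \<in> A \<times> L. fst g * x + snd g \<in> B}"
    have "?I L = ?I L1 \<union> ?I L2" unfolding L1_def L2_def by auto
    then have "card (?I L) \<le> card (?I L1) + card (?I L2)" by (simp only: card_Un_le)
    then have "c / 2 * (real N)\<^sup>2 \<le> card (?I L1) \<or> c / 2 * (real N)\<^sup>2 \<le> card (?I L2)"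
      using inc by linarith
    then show False
    proof
      assume "c / 2 * (real N)\<^sup>2 \<le> card (?I L1)"
      from e_le[OF fin(1,2) fin12(1) N(2,3) card12(1) nz12(1) this]
      have "e * real N ^ 3 \<le> card (energy_set L1)" .
      also have "\<dots> \<le> 3 / 4 * e * real N ^ 3"
      proof (rule large[OF fin12(1) card12(1) nz12(1)])
        show "P \<le> card {h \<in> L1. fst h = fst g}" if "g \<in> L1" for g
        proof -
          \<comment> \<open>\<open>L1\<close> is a union of whole slope classes of \<open>L\<close>,
            so passing to it shrinks none of them below \<open>P\<close>.\<close>
          have "{h \<in> L1. fst h = fst g} = {h \<in> L. fst h = fst g}"
            using that by (auto simp: L1_def)
          then show ?thesis using that by (simp add: L1_def)
        qed
        show "card {h \<in> L1. fst h = a} \<le> \<epsilon> * real N" for a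
        proof -
          have "card {h \<in> L1. fst h = a} \<le> card {h \<in> L. fst h = a}"
            using fin L12 by (intro card_mono) auto
          moreover have "c' * N \<le> \<epsilon> * N" using c' by (intro mult_right_mono) auto
          ultimately show ?thesis using fibre[of a] by linarith
        qed
      qed
      finally show False using e N(1) by simp
    next
      assume "c / 2 * (real N)\<^sup>2 \<le> card (?I L2)"
      from e_le[OF fin(1,2) fin12(2) N(2,3) card12(2) nz12(2) this]
      have low: "e * real N ^ 3 \<le> card (energy_set L2)" .
      moreover have "0 < e * real N ^ 3" using e N(1) by simp
      ultimately have "energy_set L2 \<noteq> {}" by auto
      then obtain g where g: "g \<in> L2" by (auto simp: energy_set_def)
      \<comment> \<open>A slope class with one element already forces \<open>1 \<le> c' * N\<close>,
        and this absorbs the summand \<open>1\<close> in \<open>1 + M * P\<close>.\<close>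
      have "card {h \<in> L. fst h = fst g} \<ge> 1"
        using g L12 fin by (auto simp: Suc_le_eq card_gt_0_iff intro!: exI[of _ "snd g"])
      then have one: "1 \<le> c' * N" using fibre[of "fst g"] by linarith
      define M where "M = nat \<lfloor>c' * N\<rfloor>"
      have M: "M \<le> c' * N" using c' by (simp add: M_def)
      have "(e * real N ^ 3)\<^sup>2 \<le> (real (card (energy_set L2)))\<^sup>2"
        using low e by (intro power_mono) auto
      also have "\<dots> \<le> real N ^ 5 * (1 + real M * real P)"
      proof (rule energy_small_fibres[OF fin12(2) card12(2) nz12(2)])
        show "card {g \<in> L2. fst g = a} \<le> P" for a
        proof (cases "{g \<in> L2. fst g = a} = {}")
          case False
          then obtain g where g: "g \<in> L2" "fst g = a" by auto
          have "card {g \<in> L2. fst g = a} \<le> card {g \<in> L. fst g = a}"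
            using fin L12 by (intro card_mono) auto
          also have "\<dots> \<le> P" using g by (simp add: L2_def)
          finally show ?thesis .
        qed (metis card.empty le0)
        show "card {g \<in> L2. u * fst g + v * snd g = w} \<le> M" if "(u, v) \<noteq> (0, 0)" for u v w
        proof -
          have "card {g \<in> L2. u * fst g + v * snd g = w} \<le> card {g \<in> L. u * fst g + v * snd g = w}"
            using fin L12 by (intro card_mono) auto
          then have "real (card {g \<in> L2. u * fst g + v * snd g = w}) \<le> c' * N"
            using poor[OF that, of w] by linarith
          then show ?thesis by (simp add: M_def le_nat_floor)
        qed
      qed
      also have "\<dots> \<le> real N ^ 5 * (c' * N + c' * N * P)"
        using one M by (intro mult_left_mono add_mono mult_right_mono) auto
      also have "\<dots> = real N ^ 6 * (c' * (1 + real P))"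
        by (simp add: algebra_simps eval_nat_numeral)
      also have "\<dots> \<le> real N ^ 6 * (e\<^sup>2 / 2)"
        using c' by (intro mult_left_mono) auto
      finally have "e\<^sup>2 * real N ^ 6 \<le> e\<^sup>2 / 2 * real N ^ 6"
        by (simp add: power_mult_distrib mult_ac flip: power_mult)
      then show False using e N(1) by simp
    qed
  qed
  show ?thesis
  proof (rule exI[of _ c'], intro conjI allI impI, goal_cases)
    case 1
    show ?case by (rule c'(1))
  next
    case (2 A B L N)
    show ?case by (rule main[of A B L N]) (use 2 in auto)
  qed
qed

section \<open>Affine coordinates and perspectivities between two lines\<close>

lemma straight_line_eq_affine_hull:
  assumes "straight_line l" "P \<in> l" "Q \<in> l" "P \<noteq> Q"
  shows "l = affine hull {P, Q}"
proof (rule sym, rule affine_dim_equal)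
  show "affine hull {P, Q} \<subseteq> l"
    using assms by (intro hull_minimal) (auto simp: straight_line_def)
  show "aff_dim (affine hull {P, Q}) = aff_dim l"
    using assms by (simp add: straight_line_def)
qed (use assms in \<open>auto simp: straight_line_def\<close>)

lemma straight_line_parametrization:
  assumes "straight_line l"
  obtains a d where "d \<noteq> 0" "l = range (\<lambda>x. a + x *\<^sub>R d)"
proof -
  have dim: "aff_dim l = 1" using assms by (simp add: straight_line_def)
  then obtain P where P: "P \<in> l" by (metis aff_dim_empty ex_in_conv zero_neq_neg_one one_neq_neg_one)
  have "l \<noteq> {P}" using dim by auto
  then obtain Q where Q: "Q \<in> l" "Q \<noteq> P" using P by blast
  have "l = affine hull {P, Q}"
    using assms P Q by (intro straight_line_eq_affine_hull) auto
  also have "\<dots> = range (\<lambda>x. P + x *\<^sub>R (Q - P))"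
    by (rule affine_hull_2_alt)
  finally have "l = range (\<lambda>x. P + x *\<^sub>R (Q - P))" .
  with Q show thesis by (intro that[of "Q - P" P]) auto
qed

definition cross2 :: "real ^ 2 \<Rightarrow> real ^ 2 \<Rightarrow> real" where
  "cross2 u v = u $ 1 * v $ 2 - u $ 2 * v $ 1"

lemma cross2_eq_0D:
  assumes "cross2 u v = 0" "u \<noteq> 0"
  obtains k where "v = k *\<^sub>R u"
proof -
  have c: "u $ 1 * v $ 2 = u $ 2 * v $ 1" using assms(1) by (simp add: cross2_def)
  have "u $ 1 \<noteq> 0 \<or> u $ 2 \<noteq> 0" using assms(2) by (simp add: vec_eq_iff forall_2)
  then show thesis
  proof
    assume "u $ 1 \<noteq> 0"
    then have "v = (v $ 1 / u $ 1) *\<^sub>R u"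
      using c by (simp add: vec_eq_iff forall_2 field_simps)
    then show thesis by (rule that)
  next
    assume "u $ 2 \<noteq> 0"
    then have "v = (v $ 2 / u $ 2) *\<^sub>R u"
      using c by (simp add: vec_eq_iff forall_2 field_simps)
    then show thesis by (rule that)
  qed
qed

locale plane_frame =
  fixes org d e :: "real ^ 2"
  assumes frame: "cross2 d e \<noteq> 0"
begin

text \<open>Cramer's rule: \<open>xc P\<close> and \<open>yc P\<close> are the coordinates of
  \<open>P\<close> in the frame with origin \<open>org\<close> and axes \<open>d\<close>,
  \<open>e\<close>.\<close>

definition xc :: "real ^ 2 \<Rightarrow> real" where "xc P = cross2 (P - org) e / cross2 d e"

definition yc :: "real ^ 2 \<Rightarrow> real" where "yc P = cross2 d (P - org) / cross2 d e"

lemma xc_eq [simp]: "xc (org + x *\<^sub>R d + y *\<^sub>R e) = x"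
  using frame by (simp add: xc_def cross2_def field_simps)

lemma yc_eq [simp]: "yc (org + x *\<^sub>R d + y *\<^sub>R e) = y"
  using frame by (simp add: yc_def cross2_def field_simps)

lemma point_eq: "P = org + xc P *\<^sub>R d + yc P *\<^sub>R e"
  using frame by (simp add: xc_def yc_def vec_eq_iff forall_2 divide_simps) (simp add: cross2_def algebra_simps)

lemma point_eqI: "xc P = xc Q \<Longrightarrow> yc P = yc Q \<Longrightarrow> P = Q"
  by (metis point_eq)

lemma straight_line_coords:
  assumes "straight_line l" "P \<in> l" "Q \<in> l" "R \<in> l"
  shows "(xc Q - xc P) * (yc R - yc P) = (xc R - xc P) * (yc Q - yc P)"
proof -
  obtain a v where l: "l = range (\<lambda>t. a + t *\<^sub>R v)"
    using straight_line_parametrization[OF assms(1)] by metis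
  define \<alpha> \<beta> where "\<alpha> = xc (org + v)" and "\<beta> = yc (org + v)"
  have v: "v = \<alpha> *\<^sub>R d + \<beta> *\<^sub>R e"
    using point_eq[of "org + v"] unfolding \<alpha>_def \<beta>_def by (metis add.assoc add_left_cancel)
  have on: "\<exists>t. xc Z = xc a + t * \<alpha> \<and> yc Z = yc a + t * \<beta>" if Z: "Z \<in> l" for Z
  proof -
    obtain t where "Z = a + t *\<^sub>R v" using Z unfolding l by auto
    also have "\<dots> = (org + xc a *\<^sub>R d + yc a *\<^sub>R e) + t *\<^sub>R v" using point_eq[of a] by simp
    also have "\<dots> = org + (xc a + t * \<alpha>) *\<^sub>R d + (yc a + t * \<beta>) *\<^sub>R e"
      unfolding v by (simp add: algebra_simps)
    finally show ?thesis by (intro exI[of _ t]) simp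
  qed
  from on[OF assms(2)] on[OF assms(3)] on[OF assms(4)] show ?thesis
    by (auto simp: algebra_simps)
qed

lemma collinear_coords:
  assumes "A \<noteq> 0 \<or> B \<noteq> 0"
  shows "collinear {P. A * xc P + B * yc P = k}"
  unfolding collinear_def
proof (intro exI[of _ "B *\<^sub>R d - A *\<^sub>R e"] ballI)
  fix P Q assume "P \<in> {P. A * xc P + B * yc P = k}" "Q \<in> {P. A * xc P + B * yc P = k}"
  then have eq: "A * (xc P - xc Q) + B * (yc P - yc Q) = 0" by (simp add: algebra_simps)
  define X Y where "X = xc P - xc Q" and "Y = yc P - yc Q"
  define s where "s = A\<^sup>2 + B\<^sup>2"
  have s: "s \<noteq> 0" using assms by (simp add: s_def sum_power2_eq_zero_iff)
  \<comment> \<open>The line has direction \<open>(B, - A)\<close>, and \<open>c\<close> is the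
    component of \<open>(X, Y)\<close> along it; the identities below split off the normal part,
    which vanishes by \<open>XY\<close>.\<close>
  define c where "c = (B * X - A * Y) / s"
  have XY: "A * X + B * Y = 0" using eq by (simp add: X_def Y_def)
  have "s * X = B * (B * X - A * Y) + A * (A * X + B * Y)"
    by (simp add: s_def power2_eq_square algebra_simps)
  then have x: "X = c * B" unfolding XY using s by (simp add: c_def eq_divide_eq mult_ac)
  have "s * Y = - A * (B * X - A * Y) + B * (A * X + B * Y)"
    by (simp add: s_def power2_eq_square algebra_simps)
  then have "Y = (- A * (B * X - A * Y)) / s"
    unfolding XY by (intro eq_divide_imp[OF s]) (simp add: mult.commute)
  then have y: "Y = - (c * A)" by (simp add: c_def mult.commute)
  have "P - Q = (org + xc P *\<^sub>R d + yc P *\<^sub>R e) - (org + xc Q *\<^sub>R d + yc Q *\<^sub>R e)"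
    using point_eq[of P] point_eq[of Q] by simp
  also have "\<dots> = X *\<^sub>R d + Y *\<^sub>R e"
    by (simp add: X_def Y_def algebra_simps)
  also have "\<dots> = c *\<^sub>R (B *\<^sub>R d - A *\<^sub>R e)"
    unfolding x y by (simp add: algebra_simps)
  finally show "\<exists>c. P - Q = c *\<^sub>R (B *\<^sub>R d - A *\<^sub>R e)" by blast
qed

end

text \<open>A point off both lines is encoded by the perspectivity \<open>l1 \<rightarrow> l2\<close> with that centre. In suitable
  coordinates on the two lines (reciprocals of the distances to the common point, if there is one)
  all these perspectivities are affine, and the coefficients of the affine map are
  a projective transformation of the centre, so that collinearity is preserved.\<close>

definition perspectivity_chart ::
  "(real ^ 2) set \<Rightarrow> (real ^ 2) set \<Rightarrow> (real ^ 2 \<Rightarrow> real) \<Rightarrow> (real ^ 2 \<Rightarrow> real) \<Rightarrow> (real ^ 2 \<Rightarrow> real \<times> real) \<Rightarrow> bool" where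
  "perspectivity_chart l1 l2 X Y G \<longleftrightarrow> inj_on X l1 \<and> inj_on G (- (l1 \<union> l2)) \<and>
    (\<forall>P. P \<notin> l1 \<longrightarrow> P \<notin> l2 \<longrightarrow> fst (G P) \<noteq> 0) \<and>
    (\<forall>l P Q R. straight_line l \<longrightarrow> P \<in> l \<longrightarrow> Q \<in> l \<longrightarrow> R \<in> l \<longrightarrow> P \<in> l1 \<longrightarrow> Q \<in> l2 \<longrightarrow> R \<notin> l1 \<longrightarrow> R \<notin> l2 \<longrightarrow>
      P \<noteq> Q \<longrightarrow> fst (G R) * X P + snd (G R) = Y Q) \<and>
    (\<forall>u v w. (u, v) \<noteq> (0, 0) \<longrightarrow>
      collinear {P. P \<notin> l1 \<and> P \<notin> l2 \<and> u * fst (G P) + v * snd (G P) = w})"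

lemma perspectivity_chart_exists:
  assumes "straight_line l1" "straight_line l2" "l1 \<noteq> l2"
  obtains X Y G where "perspectivity_chart l1 l2 X Y G"
proof -
  obtain a1 d1 where d1: "d1 \<noteq> 0" and l1: "l1 = range (\<lambda>x. a1 + x *\<^sub>R d1)"
    using straight_line_parametrization[OF assms(1)] .
  obtain a2 d2 where d2: "d2 \<noteq> 0" and l2: "l2 = range (\<lambda>x. a2 + x *\<^sub>R d2)"
    using straight_line_parametrization[OF assms(2)] .
  show thesis
  proof (cases "cross2 d1 d2 = 0")
    case False
    \<comment> \<open>This is the intersection point, by Cramer's rule; with \<open>z\<close> as
      origin the two lines are the coordinate axes.\<close>
    define z where "z = a1 + (cross2 (a2 - a1) d2 / cross2 d1 d2) *\<^sub>R d1"
    interpret F0: plane_frame a1 d1 d2 by unfold_locales (rule False)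
    interpret plane_frame z d1 d2 by unfold_locales (rule False)
    have z1: "z = a1 + F0.xc a2 *\<^sub>R d1" by (simp add: z_def F0.xc_def)
    have z2: "a2 = z + F0.yc a2 *\<^sub>R d2" unfolding z1 by (rule F0.point_eq)
    have mem1: "P \<in> l1 \<longleftrightarrow> yc P = 0" for P
    proof
      assume "P \<in> l1"
      then obtain x where "P = a1 + x *\<^sub>R d1" unfolding l1 by auto
      then have "P = z + (x - F0.xc a2) *\<^sub>R d1 + 0 *\<^sub>R d2" unfolding z1 by (simp add: algebra_simps)
      then show "yc P = 0" by (metis yc_eq)
    next
      assume "yc P = 0"
      then have "P = a1 + (F0.xc a2 + xc P) *\<^sub>R d1" using point_eq[of P] unfolding z1 by (simp add: algebra_simps)
      then show "P \<in> l1" unfolding l1 by blast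
    qed
    have mem2: "P \<in> l2 \<longleftrightarrow> xc P = 0" for P
    proof
      assume "P \<in> l2"
      then obtain x where "P = a2 + x *\<^sub>R d2" unfolding l2 by auto
      then have "P = z + 0 *\<^sub>R d1 + (x + F0.yc a2) *\<^sub>R d2" using z2 by (simp add: algebra_simps)
      then show "xc P = 0" by (metis xc_eq)
    next
      assume "xc P = 0"
      then have "P = z + yc P *\<^sub>R d2" using point_eq[of P] by simp
      also have "\<dots> = a2 + (yc P - F0.yc a2) *\<^sub>R d2" using z2 by (simp add: algebra_simps)
      finally show "P \<in> l2" unfolding l2 by blast
    qed
    show thesis
    \<comment> \<open>A line through \<open>(x, 0)\<close>, \<open>(0, y)\<close> and
      \<open>(p, q)\<close> satisfies \<open>p / x + q / y = 1\<close>, that is,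
      \<open>1 / y = - p / q * (1 / x) + 1 / q\<close>.\<close>
    proof (rule that[of "\<lambda>P. 1 / xc P" "\<lambda>P. 1 / yc P" "\<lambda>P. (- xc P / yc P, 1 / yc P)"],
        unfold perspectivity_chart_def, intro conjI allI impI)
      \<comment> \<open>Injectivity includes the common point, as \<open>1 / 0 = 0\<close>.\<close>
      show "inj_on (\<lambda>P. 1 / xc P) l1"
        by (auto intro!: inj_onI point_eqI simp: mem1)
      show "inj_on (\<lambda>P. (- xc P / yc P, 1 / yc P)) (- (l1 \<union> l2))"
        by (auto intro!: inj_onI point_eqI simp: mem1)
      show "fst (- xc P / yc P, 1 / yc P) \<noteq> 0" if "P \<notin> l1" "P \<notin> l2" for P
        using that by (simp add: mem1 mem2)
    next
      fix l P Q R
      assume l: "straight_line l" "P \<in> l" "Q \<in> l" "R \<in> l"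
        and "P \<in> l1" "Q \<in> l2" "R \<notin> l1" "R \<notin> l2" and "P \<noteq> Q"
      then have c: "yc P = 0" "xc Q = 0" "yc R \<noteq> 0" "xc R \<noteq> 0" by (simp_all add: mem1 mem2)
      from straight_line_coords[OF l] have eq: "xc P * yc Q = xc P * yc R + xc R * yc Q"
        using c by (simp add: algebra_simps)
      \<comment> \<open>Neither \<open>P\<close> nor \<open>Q\<close> is the origin: a line through
        the origin and \<open>R\<close> meets both axes only there, against
        \<open>P \<noteq> Q\<close>.\<close>
      have "xc P \<noteq> 0"
      proof
        assume "xc P = 0"
        then have "yc Q = 0" using eq c by simp
        then show False using \<open>P \<noteq> Q\<close> \<open>xc P = 0\<close> c by (auto intro: point_eqI)
      qed
      moreover have "yc Q \<noteq> 0"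
      proof
        assume "yc Q = 0"
        then have "xc P = 0" using eq c by simp
        then show False using \<open>xc P \<noteq> 0\<close> by simp
      qed
      ultimately show "fst (- xc R / yc R, 1 / yc R) * (1 / xc P) + snd (- xc R / yc R, 1 / yc R) = 1 / yc Q"
        using eq c by (simp add: field_simps)
    next
      fix u v w :: real
      assume uv: "(u, v) \<noteq> (0, 0)"
      let ?S = "{P. P \<notin> l1 \<and> P \<notin> l2 \<and> u * fst (- xc P / yc P, 1 / yc P) + v * snd (- xc P / yc P, 1 / yc P) = w}"
      have S: "u * xc P + w * yc P = v \<and> yc P \<noteq> 0" if "P \<in> ?S" for P
        using that by (auto simp: mem1 field_simps)
      show "collinear ?S"
      \<comment> \<open>For \<open>u = w = 0\<close> the set corresponds to the line at infinity and
        is empty.\<close>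
      proof (cases "?S = {}")
        case False
        then obtain P where "P \<in> ?S" by blast
        then have "u \<noteq> 0 \<or> w \<noteq> 0" using S uv by fastforce
        from collinear_coords[OF this, of v] show ?thesis
          by (rule collinear_subset) (use S in blast)
      qed (metis collinear_empty)
    qed
  next
    case True
    then obtain k where k: "d2 = k *\<^sub>R d1" using cross2_eq_0D d1 by metis
    then have "k \<noteq> 0" using d2 by auto
    have l2': "l2 = range (\<lambda>x. a2 + x *\<^sub>R d1)"
    proof -
      have "a2 + x *\<^sub>R d2 = a2 + (x * k) *\<^sub>R d1" "a2 + x *\<^sub>R d1 = a2 + (x / k) *\<^sub>R d2" for x
        using \<open>k \<noteq> 0\<close> unfolding k by auto
      then show ?thesis unfolding l2 by (intro equalityI subsetI; elim rangeE) (metis rangeI)+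
    qed
    have "cross2 d1 (a2 - a1) \<noteq> 0"
    proof
      assume "cross2 d1 (a2 - a1) = 0"
      then obtain m where "a2 - a1 = m *\<^sub>R d1" using cross2_eq_0D d1 by metis
      then have a2: "a2 = a1 + m *\<^sub>R d1" by (simp add: algebra_simps)
      have "a2 + x *\<^sub>R d1 = a1 + (m + x) *\<^sub>R d1" "a1 + x *\<^sub>R d1 = a2 + (x - m) *\<^sub>R d1" for x
        unfolding a2 by (simp_all add: algebra_simps)
      then have "l1 = l2" unfolding l1 l2' by (intro equalityI subsetI; elim rangeE) (metis rangeI)+
      then show False using assms(3) by simp
    qed
    then interpret plane_frame a1 d1 "a2 - a1" by unfold_locales
    have mem1: "P \<in> l1 \<longleftrightarrow> yc P = 0" for P
    proof
      assume "P \<in> l1"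
      then obtain x where "P = a1 + x *\<^sub>R d1 + 0 *\<^sub>R (a2 - a1)" unfolding l1 by auto
      then show "yc P = 0" by (metis yc_eq)
    next
      assume "yc P = 0"
      then show "P \<in> l1" using point_eq[of P] unfolding l1 by auto
    qed
    have mem2: "P \<in> l2 \<longleftrightarrow> yc P = 1" for P
    proof
      assume "P \<in> l2"
      then obtain x where "P = a2 + x *\<^sub>R d1" unfolding l2' by auto
      then have "P = a1 + x *\<^sub>R d1 + 1 *\<^sub>R (a2 - a1)" by simp
      then show "yc P = 1" by (metis yc_eq)
    next
      assume "yc P = 1"
      then have "P = a2 + xc P *\<^sub>R d1" using point_eq[of P] by (simp add: add.commute)
      then show "P \<in> l2" unfolding l2' by blast
    qed
    show thesis
    \<comment> \<open>With \<open>l1\<close> at height \<open>0\<close> and \<open>l2\<close> at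
      height \<open>1\<close>, the line through \<open>(x, 0)\<close> and \<open>(p, q)\<close>
      reaches height \<open>1\<close> at \<open>x + (p - x) / q\<close>.\<close>
    proof (rule that[of xc xc "\<lambda>P. (- (1 - yc P) / yc P, xc P / yc P)"],
        unfold perspectivity_chart_def, intro conjI allI impI)
      show "inj_on xc l1"
        by (auto intro!: inj_onI point_eqI simp: mem1)
      show "inj_on (\<lambda>P. (- (1 - yc P) / yc P, xc P / yc P)) (- (l1 \<union> l2))"
        by (auto intro!: inj_onI point_eqI simp: mem1 diff_divide_distrib)
      show "fst (- (1 - yc P) / yc P, xc P / yc P) \<noteq> 0" if "P \<notin> l1" "P \<notin> l2" for P
        using that by (simp add: mem1 mem2)
    next
      fix l P Q R
      assume l: "straight_line l" "P \<in> l" "Q \<in> l" "R \<in> l"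
        and "P \<in> l1" "Q \<in> l2" "R \<notin> l1" "R \<notin> l2" and "P \<noteq> Q"
      then have c: "yc P = 0" "yc Q = 1" "yc R \<noteq> 0" by (simp_all add: mem1 mem2)
      from straight_line_coords[OF l] show "fst (- (1 - yc R) / yc R, xc R / yc R) * xc P + snd (- (1 - yc R) / yc R, xc R / yc R) = xc Q"
        using c by (simp add: field_simps)
    next
      fix u v w :: real
      assume uv: "(u, v) \<noteq> (0, 0)"
      let ?S = "{P. P \<notin> l1 \<and> P \<notin> l2 \<and> u * fst (- (1 - yc P) / yc P, xc P / yc P) + v * snd (- (1 - yc P) / yc P, xc P / yc P) = w}"
      have S: "v * xc P + (u - w) * yc P = u" if "P \<in> ?S" for P
        using that by (auto simp: mem1 field_simps)
      show "collinear ?S"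
      proof (cases "?S = {}")
        case False
        then obtain P where "P \<in> ?S" by blast
        then have "v \<noteq> 0 \<or> u - w \<noteq> 0" using S uv by fastforce
        from collinear_coords[OF this, of u] show ?thesis
          by (rule collinear_subset) (use S in blast)
      qed (metis collinear_empty)
    qed
  qed
qed

section \<open>Triple lines as incidences of affine maps\<close>

theorem theorem5p1:
  fixes c C :: real
  assumes "c > 0" and "C \<ge> 1"
  shows "\<exists>cstar::real. cstar > 0 \<and>
    (\<forall>(n::nat) (H1 :: (real ^ 2) set) H2 H3 l1 l2.
       n \<ge> 1 \<longrightarrow>
       finite H1 \<longrightarrow> finite H2 \<longrightarrow> finite H3 \<longrightarrow>
       n \<le> card H1 \<longrightarrow> real (card H1) \<le> C * real n \<longrightarrow>
       n \<le> card H2 \<longrightarrow> real (card H2) \<le> C * real n \<longrightarrow>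
       n \<le> card H3 \<longrightarrow> real (card H3) \<le> C * real n \<longrightarrow>
       straight_line l1 \<longrightarrow> straight_line l2 \<longrightarrow> l1 \<noteq> l2 \<longrightarrow>
       H1 \<subseteq> l1 \<longrightarrow> H2 \<subseteq> l2 \<longrightarrow>
       H3 \<inter> l1 = {} \<longrightarrow> H3 \<inter> l2 = {} \<longrightarrow>
       real (card (triple_lines H1 H2 H3)) \<ge> c * (real n)\<^sup>2 \<longrightarrow>
       (\<exists>S. S \<subseteq> H3 \<and> collinear S \<and> real (card S) \<ge> cstar * real n))"
proof -
  \<comment> \<open>The common size bound \<open>N\<close> may be as large as \<open>C * n\<close>,
    so \<open>c * n\<^sup>2\<close> lines amount to a proportion \<open>c / C\<^sup>2\<close> of
    \<open>N\<^sup>2\<close>.\<close>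
  have "c / C\<^sup>2 > 0" using assms by simp
  from rich_affine_maps_collinear[OF this] obtain c' :: real where c': "c' > 0"
    and rich: "\<forall>A B (L :: (real \<times> real) set) N. finite A \<longrightarrow> finite B \<longrightarrow> finite L \<longrightarrow> N \<ge> 1 \<longrightarrow>
      card A \<le> N \<longrightarrow> card B \<le> N \<longrightarrow> card L \<le> N \<longrightarrow> (\<forall>g\<in>L. fst g \<noteq> 0) \<longrightarrow>
      c / C\<^sup>2 * (real N)\<^sup>2 \<le> card {(x, g) \<in> A \<times> L. fst g * x + snd g \<in> B} \<longrightarrow>
      (\<exists>u v w. (u, v) \<noteq> (0 :: real, 0 :: real) \<and> c' * N \<le> card {g \<in> L. u * fst g + v * snd g = w})"
    by (elim exE conjE) (rule that)
  show ?thesis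
  proof (rule exI[of _ c'], intro conjI allI impI)
    show "c' > 0" by (rule c')
  next
    fix n :: nat and H1 H2 H3 l1 l2 :: "(real ^ 2) set"
    assume n: "n \<ge> 1" and fin: "finite H1" "finite H2" "finite H3"
      and H1: "n \<le> card H1" "real (card H1) \<le> C * real n"
      and H2: "n \<le> card H2" "real (card H2) \<le> C * real n"
      and H3: "n \<le> card H3" "real (card H3) \<le> C * real n"
      and l: "straight_line l1" "straight_line l2" "l1 \<noteq> l2"
      and sub: "H1 \<subseteq> l1" "H2 \<subseteq> l2" and off: "H3 \<inter> l1 = {}" "H3 \<inter> l2 = {}"
      and many: "real (card (triple_lines H1 H2 H3)) \<ge> c * (real n)\<^sup>2"
    obtain X Y G where chart: "perspectivity_chart l1 l2 X Y G"
      using perspectivity_chart_exists[OF l] .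
    then have inj: "inj_on X l1" "inj_on G (- (l1 \<union> l2))"
      and nz: "\<And>P. P \<notin> l1 \<Longrightarrow> P \<notin> l2 \<Longrightarrow> fst (G P) \<noteq> 0"
      and coll: "\<And>u v w. (u, v) \<noteq> (0, 0) \<Longrightarrow>
        collinear {P. P \<notin> l1 \<and> P \<notin> l2 \<and> u * fst (G P) + v * snd (G P) = w}"
      by (simp_all add: perspectivity_chart_def)
    have persp: "fst (G R) * X P + snd (G R) = Y Q"
      if "straight_line l" "P \<in> l" "Q \<in> l" "R \<in> l" "P \<in> l1" "Q \<in> l2" "R \<notin> l1" "R \<notin> l2" "P \<noteq> Q" for l P Q R
      using chart that unfolding perspectivity_chart_def by blast
    define N where "N = nat \<lfloor>C * real n\<rfloor>"
    have N: "card H1 \<le> N" "card H2 \<le> N" "card H3 \<le> N"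
      using H1(2) H2(2) H3(2) by (auto simp: N_def le_nat_floor)
    have "real N \<le> C * n" using assms n by (simp add: N_def)
    have "n \<le> N" using N(1) H1(1) by simp
    let ?A = "X ` H1" and ?B = "Y ` H2" and ?L = "G ` H3"
    let ?I = "{(x, g) \<in> ?A \<times> ?L. fst g * x + snd g \<in> ?B}"
    have "\<exists>z. fst z \<in> l \<inter> H1 \<and> snd z \<in> l \<inter> H3 \<and> fst z \<noteq> snd z \<and> (X (fst z), G (snd z)) \<in> ?I"
      if l: "l \<in> triple_lines H1 H2 H3" for l
    proof -
      from l obtain P Q R where PQR: "straight_line l" "P \<in> l \<inter> H1" "Q \<in> l \<inter> H2" "R \<in> l \<inter> H3" "P \<noteq> Q" "P \<noteq> R"
        unfolding triple_lines_def by blast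
      then have "fst (G R) * X P + snd (G R) = Y Q"
        using sub off by (intro persp[of l]) auto
      then have "(X P, G R) \<in> ?I" using PQR by auto
      then show ?thesis
        using PQR by (intro exI[of _ "(P, R)"]) auto
    qed
    then have "\<forall>l\<in>triple_lines H1 H2 H3. \<exists>z. fst z \<in> l \<inter> H1 \<and> snd z \<in> l \<inter> H3 \<and> fst z \<noteq> snd z
        \<and> (X (fst z), G (snd z)) \<in> ?I" by (rule ballI)
    from bchoice[OF this] obtain p where p_all: "\<forall>l\<in>triple_lines H1 H2 H3. fst (p l) \<in> l \<inter> H1
        \<and> snd (p l) \<in> l \<inter> H3 \<and> fst (p l) \<noteq> snd (p l) \<and> (X (fst (p l)), G (snd (p l))) \<in> ?I" ..
    note p = bspec[OF p_all]
    \<comment> \<open>A triple line is recovered from its chosen points in \<open>H1\<close> and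
      \<open>H3\<close>, which are distinct and are determined by their images under
      \<open>X\<close> and \<open>G\<close>; it can thus be charged to one incidence.\<close>
    have "card (triple_lines H1 H2 H3) \<le> card ?I"
    proof (rule card_inj_on_le[of "\<lambda>l. (X (fst (p l)), G (snd (p l)))"])
      show "inj_on (\<lambda>l. (X (fst (p l)), G (snd (p l)))) (triple_lines H1 H2 H3)"
      proof (rule inj_onI)
        fix l l' assume ll: "l \<in> triple_lines H1 H2 H3" "l' \<in> triple_lines H1 H2 H3"
          and eq: "(X (fst (p l)), G (snd (p l))) = (X (fst (p l')), G (snd (p l')))"
        have "fst (p l) = fst (p l')" "snd (p l) = snd (p l')"
          using inj eq p[OF ll(1)] p[OF ll(2)] sub off by (auto dest!: inj_onD)
        moreover have "straight_line l" "straight_line l'"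
          using ll by (auto simp: triple_lines_def)
        ultimately show "l = l'"
          using straight_line_eq_affine_hull[of l "fst (p l)" "snd (p l)"]
            straight_line_eq_affine_hull[of l' "fst (p l)" "snd (p l)"] p[OF ll(1)] p[OF ll(2)] by auto
      qed
      show "(\<lambda>l. (X (fst (p l)), G (snd (p l)))) ` triple_lines H1 H2 H3 \<subseteq> ?I"
      proof (rule image_subsetI)
        fix l assume "l \<in> triple_lines H1 H2 H3"
        from p[OF this] show "(X (fst (p l)), G (snd (p l))) \<in> ?I" by (elim conjE)
      qed
      show "finite ?I"
        by (rule finite_subset[of _ "?A \<times> ?L"]) (use fin in auto)
    qed
    have "c / C\<^sup>2 * (real N)\<^sup>2 \<le> c / C\<^sup>2 * (C * n)\<^sup>2"
      using assms \<open>real N \<le> C * n\<close> by (intro mult_left_mono power_mono) auto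
    also have "\<dots> = c * (real n)\<^sup>2" using assms by (simp add: power_mult_distrib)
    finally have "c / C\<^sup>2 * (real N)\<^sup>2 \<le> card ?I"
      using many \<open>card (triple_lines H1 H2 H3) \<le> card ?I\<close> by linarith
    moreover have "fst g \<noteq> 0" if "g \<in> ?L" for g using that nz off by auto
    ultimately obtain u v w where uv: "(u, v) \<noteq> (0 :: real, 0 :: real)"
      and line: "c' * N \<le> card {g \<in> ?L. u * fst g + v * snd g = w}"
      using rich[rule_format, of ?A ?B ?L N] fin N n \<open>n \<le> N\<close>
        card_image_le[OF fin(1), of X] card_image_le[OF fin(2), of Y] card_image_le[OF fin(3), of G]
      by fastforce
    let ?S = "{P \<in> H3. u * fst (G P) + v * snd (G P) = w}"
    have "{g \<in> ?L. u * fst g + v * snd g = w} = G ` ?S" by auto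
    then have "card {g \<in> ?L. u * fst g + v * snd g = w} \<le> card ?S"
      using fin by (simp add: card_image_le)
    then have "c' * N \<le> card ?S" using line by linarith
    moreover have "c' * n \<le> c' * N" using c' \<open>n \<le> N\<close> by simp
    ultimately have "c' * n \<le> card ?S" by linarith
    moreover have "collinear ?S"
      by (rule collinear_subset[OF coll[OF uv, of w]]) (use off in auto)
    ultimately show "\<exists>S\<subseteq>H3. collinear S \<and> c' * real n \<le> real (card S)"
      by (intro exI[of _ ?S]) auto
  qed
qed

end
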